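(* Let $Y$ be a (proper) Young diagram. Then $|S_Y(213)|<|S_Y(123)|$ if and only if $Y$ contains an $i$-critical point with $i\geq 2$; and $|S_Y(123)|<|S_Y(312)|$ if and only if $Y$ contains an $i$-critical point with $i\geq 3$.
   Context: Permutations $\tau\in S_k$ are written in one-line notation. $Y(a_1,\ldots,a_n)$, with $a_1\ge a_2\ge\cdots\ge a_n\ge 1$, denotes the left-justified Young diagram whose $i$-th row from the top has $a_i$ cells. Cells are coordinatized from the bottom left corner: $(x,y)$ is the cell in column $x$ (from the left) and row $y$ (from the bottom). A Young diagram of size $n$ is proper if it has exactly $n$ rows and $n$ columns and contains the staircase $Y(n,n-1,\ldots,2,1)$; all Young diagrams are assumed proper. A transversal $T$ of $Y$ is a set of $n$ cells of $Y$ with exactly one in every row and every column; equivalently a permutation $\pi$ of $\{1,\ldots,n\}$ such that every cell $(x,\pi(x))$ lies in $Y$. $T$ contains the pattern $\tau\in S_k$ in $Y$ if there are columns $x_1<\cdots<x_k$ such that $(\pi(x_1),\ldots,\pi(x_k))$ is order-isomorphic to $\tau$ and the cell $(x_k,\min_j\pi(x_j))$ belongs to $Y$. $S_Y(\tau)$ is the set of transversals of $Y$ that do not contain $\tau$ in $Y$. Grid points have integer coordinates so that cell $(x,y)$ is the unit square $[x-1,x]\times[y-1,y]$. The border of $Y$ is the lattice path with unit right and up steps that starts at the bottom left corner $(0,0)$, follows the outline of $Y$ below and to the right of the main diagonal, and ends at the top right corner $(n,n)$. A grid point $P$ on the border is a critical point of $Y$ if the border goes upwards to enter $P$ and then goes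 to the right to leave $P$. A critical point $P=(x,y)$ is $i$-critical if $x-y=i$. *)

theory Defs
  imports "HOL-Combinatorics.Combinatorics"
begin

text \<open>
  A Young diagram is given by its list of row lengths \<open>a = [a\<^sub>1, \<dots>, a\<^sub>n]\<close>, from the top row to the
  bottom row. Cells are pairs (column, row) with rows counted from the bottom, starting at 1;
  hence row \<open>y\<close> has \<open>a ! (length a - y)\<close> cells.
\<close>

definition young_diagram :: "nat list \<Rightarrow> bool" where
  "young_diagram a \<longleftrightarrow> sorted_wrt (\<ge>) a \<and> (\<forall>k\<in>set a. 1 \<le> k)"

definition cells :: "nat list \<Rightarrow> (nat \<times> nat) set" where
  "cells a = {(x, y). 1 \<le> y \<and> y \<le> length a \<and> 1 \<le> x \<and> x \<le> a ! (length a - y)}"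

definition staircase :: "nat \<Rightarrow> nat list" where
  "staircase n = rev [1..<Suc n]"

definition proper_young_diagram :: "nat \<Rightarrow> nat list \<Rightarrow> bool" where
  "proper_young_diagram n a \<longleftrightarrow>
     young_diagram a \<and> length a = n \<and> fst ` cells a = {1..n} \<and> cells (staircase n) \<subseteq> cells a"

text \<open>
  A transversal is represented by its permutation of \<open>{1..n}\<close>, as a function that is the identity
  outside \<open>{1..n}\<close>, so that distinct functions are distinct transversals.
\<close>

definition transversals :: "nat list \<Rightarrow> (nat \<Rightarrow> nat) set" where
  "transversals a =
     {\<pi>. \<pi> permutes {1..length a} \<and> (\<forall>x\<in>{1..length a}. (x, \<pi> x) \<in> cells a)}"

definition order_isomorphic :: "nat list \<Rightarrow> nat list \<Rightarrow> bool" where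
  "order_isomorphic us vs \<longleftrightarrow>
     length us = length vs \<and>
     (\<forall>i<length us. \<forall>j<length us. us ! i < us ! j \<longleftrightarrow> vs ! i < vs ! j)"

definition contains_pattern :: "nat list \<Rightarrow> (nat \<Rightarrow> nat) \<Rightarrow> nat list \<Rightarrow> bool" where
  "contains_pattern a \<pi> \<tau> \<longleftrightarrow>
     (\<exists>xs. sorted_wrt (<) xs \<and> set xs \<subseteq> {1..length a} \<and>
        order_isomorphic (map \<pi> xs) \<tau> \<and> (last xs, Min (\<pi> ` set xs)) \<in> cells a)"

definition avoiders :: "nat list \<Rightarrow> nat list \<Rightarrow> (nat \<Rightarrow> nat) set" where
  "avoiders a \<tau> = {\<pi> \<in> transversals a. \<not> contains_pattern a \<pi> \<tau>}"

datatype step = Rightwards | Upwards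

text \<open>
  The rows are traversed from the bottom; the path moves right to the end of the
  current row and then up along the right side of its last cell. The first argument is the
  abscissa reached so far.
\<close>

fun border_from :: "nat \<Rightarrow> nat list \<Rightarrow> step list" where
  "border_from x [] = []"
| "border_from x (b # bs) = replicate (b - x) Rightwards @ Upwards # border_from b bs"

definition border :: "nat list \<Rightarrow> step list" where
  "border a = border_from 0 (rev a)"

definition border_point :: "nat list \<Rightarrow> nat \<Rightarrow> nat \<times> nat" where
  "border_point a k =
     (count_list (take k (border a)) Rightwards, count_list (take k (border a)) Upwards)"

definition critical_point :: "nat list \<Rightarrow> nat \<times> nat \<Rightarrow> bool" where
  "critical_point a P \<longleftrightarrow>
     (\<exists>k. Suc k < length (border a) \<and> border a ! k = Upwards \<and> border a ! Suc k = Rightwards \<and>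
        P = border_point a (Suc k))"

definition i_critical_point :: "nat list \<Rightarrow> int \<Rightarrow> nat \<times> nat \<Rightarrow> bool" where
  "i_critical_point a i P \<longleftrightarrow> critical_point a P \<and> int (fst P) - int (snd P) = i"

end

theory Submission
  imports Defs
begin

text \<open>
  Rows are processed from the bottom and columns from the left, that is, along the border. Reading a
  transversal by rows as a list of columns, a step to the right inserts a new largest entry (the new
  column) somewhere in the part of the list above the finished rows, and an upward step finishes the
  lowest unfinished row. Whether the insertion creates a forbidden pattern depends only on the
  order of the unfinished rows: for 213 (for 123) the entries below the new one must increase
  (decrease), and for 321 those above it must increase. So each of the three numbers of avoiders is
  the number of evolutions of a small state along the border
  (\<open>card_avoiders_213\<close>, \<open>card_avoiders_123\<close>, \<open>card_avoiders_321\<close>): for 213 and 123 the state is the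
  decomposition of the unfinished rows into monotone runs, for 321 it is the length of the top
  increasing run.

  \<^item> 213 against 123. From states with first runs of the same length both processes offer the
    same choices, and the 213 state always stays a refinement of the 123 state, whence \<open>\<le>\<close>. The
    states differ in the length of the first run only if a run was merged, and this influences the
    number of choices only at a step to the right that follows an upward step at height at least 2
    above the diagonal. That is a critical point with \<open>i \<ge> 2\<close>
    (\<open>num213_less_num123\<close>, \<open>num213_eq_num123\<close>).

  \<^item> 123 against 321. Both are equinumerous on every diagram (\<open>num123_eq_num321\<close>). The run
    decompositions of the 123 process are those of ballot words, where a run ends inside every factor
    ``right, up''. Summed over all ballot words with a given length and end level, the numbers of the
    123 process obey the same recursion as the numbers of lattice paths that the 321 process counts.
    Inserting or deleting a letter may break the ballot condition; changing the first offending
    letter repairs this and does not alter the runs.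

  \<^item> 321 against 312. The left-to-right maxima determine a 321-avoiding transversal. Every set of
    left-to-right maxima of a transversal also belongs to some 321-avoiding and to some
    312-avoiding one, since exchanging the two smaller entries of an occurrence of either pattern keeps
    the left-to-right maxima. So there are at least as many 312-avoiders as 321-avoiders, and there are
    more iff two 312-avoiders share their left-to-right maxima. Comparing two such transversals at the
    lowest row where they differ produces a critical point with \<open>i \<ge> 3\<close>, and conversely such a point
    allows two explicit 312-avoiders that differ in only three columns
    (\<open>corner_of_two_312_avoiders\<close>, \<open>corner_filling_avoids_312\<close>).
\<close>

section \<open>The run processes for 213 and 123\<close>

definition insert_at :: "nat \<Rightarrow> 'a \<Rightarrow> 'a list \<Rightarrow> 'a list" where
  "insert_at i m xs = take i xs @ m # drop i xs"

text \<open>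
  The unfinished rows are split into runs. A state is a Boolean list with one entry per unfinished row,
  where \<open>True\<close> marks the row at which a new run starts. The first row always starts a run, so the first
  entry of a state carries no information; \<open>lead\<close> is applied to the list without it, and the first run has
  \<open>Suc (lead B)\<close> rows.
\<close>

definition lead :: "bool list \<Rightarrow> nat" where
  "lead B = length (takeWhile Not B)"

fun unset :: "bool list \<Rightarrow> bool list" where
  "unset [] = []"
| "unset (b # B) = False # B"

text \<open>
  A new run starts at position \<open>i\<close>, and the row that was at this position and now follows it no
  longer starts one.
\<close>

definition merge_at :: "nat \<Rightarrow> bool list \<Rightarrow> bool list" where
  "merge_at i B = take i B @ True # unset (drop i B)"

text \<open>
  The number of ways to follow the border word from a given state, for the pattern 213: the runs are
  increasing, and the new column is inserted after at most the whole first run. Inserted at the end of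
  the first run it extends this run, otherwise it ends a run that consists of it and the entries below.
  The first summand is the extension of the first run.
\<close>

fun num213 :: "bool list \<Rightarrow> step list \<Rightarrow> nat" where
  "num213 B [] = 1"
| "num213 B (Upwards # s) = num213 (tl B) s"
| "num213 [] (Rightwards # s) = num213 [False] s"
| "num213 (b # B) (Rightwards # s) =
     num213 (b # False # B) s + (\<Sum>i\<le>lead B. num213 (b # insert_at i True B) s)"

text \<open>
  The same for the pattern 123, with decreasing runs: the new column extends the first run if it is
  inserted below it, otherwise it starts a run together with all that follows in the first run. Inserted
  after the whole first run it is merged with the second run; this is the only difference to
  \<open>num213\<close>.
\<close>

fun num123 :: "bool list \<Rightarrow> step list \<Rightarrow> nat" where
  "num123 B [] = 1"
| "num123 B (Upwards # s) = num123 (tl B) s"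
| "num123 [] (Rightwards # s) = num123 [False] s"
| "num123 (b # B) (Rightwards # s) =
     num123 (b # False # B) s + (\<Sum>i\<le>lead B. num123 (b # merge_at i B) s)"

declare num213.simps(4) [simp del] num123.simps(4) [simp del]

text \<open>
  A border word leads from height \<open>h\<close> above the diagonal to height \<open>g\<close> without descending
  below height 0. Words of steps also serve as ballot words below.
\<close>

fun leads_to :: "nat \<Rightarrow> step list \<Rightarrow> nat \<Rightarrow> bool" where
  "leads_to h [] g \<longleftrightarrow> h = g"
| "leads_to h (Upwards # s) g \<longleftrightarrow> h > 0 \<and> leads_to (h - 1) s g"
| "leads_to h (Rightwards # s) g \<longleftrightarrow> leads_to (Suc h) s g"

lemma leads_to_append:
  "leads_to h (u @ v) g \<longleftrightarrow> (\<exists>m. leads_to h u m \<and> leads_to m v g)"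
  by (induction h u g rule: leads_to.induct) auto

lemma leads_to_count:
  "leads_to h s g \<Longrightarrow> h + count_list s Rightwards = g + count_list s Upwards"
  by (induction h s g rule: leads_to.induct) auto

lemma leads_to_unique: "leads_to h s g \<Longrightarrow> leads_to h s g' \<Longrightarrow> g = g'"
  using leads_to_count[of h s g] leads_to_count[of h s g'] by simp

lemma num123_pos: "0 < num123 B s"
proof (induction s arbitrary: B)
  case (Cons x s)
  show ?case
    by (cases x; cases B) (use Cons in \<open>auto simp: num123.simps(4)\<close>)
qed simp

lemma num213_ups: "num213 A (replicate u Upwards @ s) = num213 (drop u A) s"
  by (induction u arbitrary: A) (auto simp: drop_Suc)

lemma num123_ups: "num123 A (replicate u Upwards @ s) = num123 (drop u A) s"
  by (induction u arbitrary: A) (auto simp: drop_Suc)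

text \<open>
  The runs of the first state subdivide those of the second.
\<close>

abbreviation refines :: "bool list \<Rightarrow> bool list \<Rightarrow> bool" where
  "refines \<equiv> list_all2 (\<lambda>x y. y \<longrightarrow> x)"

lemma lead_simps [simp]: "lead [] = 0" "lead (b # B) = (if b then 0 else Suc (lead B))"
  by (auto simp: lead_def)

lemma lead_le_length: "lead B \<le> length B"
  by (induction B) auto

lemma lead_insert_at: "i \<le> lead B \<Longrightarrow> lead (insert_at i True B) = i"
  unfolding insert_at_def
proof (induction B arbitrary: i)
  case (Cons b B)
  then show ?case by (cases i) (auto split: if_splits)
qed simp

lemma lead_merge_at: "i \<le> lead B \<Longrightarrow> lead (merge_at i B) = i"
  unfolding merge_at_def
proof (induction B arbitrary: i)
  case (Cons b B)
  then show ?case by (cases i) (auto split: if_splits)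
qed simp

lemma length_insert_at [simp]: "length (insert_at i m B) = Suc (length B)"
  by (simp add: insert_at_def)

lemma length_unset [simp]: "length (unset B) = length B"
  by (cases B) auto

lemma length_merge_at [simp]: "length (merge_at i B) = Suc (length B)"
  by (simp add: merge_at_def)

lemma lead_mono: "refines A B \<Longrightarrow> lead A \<le> lead B"
  by (induction A B rule: list_all2_induct) auto

lemma refines_unset: "refines A B \<Longrightarrow> refines A (unset B)"
  by (induction A B rule: list_all2_induct) auto

lemma refines_children:
  assumes "refines A B"
  shows "refines (insert_at i True A) (merge_at i B)"
  unfolding insert_at_def merge_at_def
  using assms by (intro list_all2_appendI list_all2_takeI) (auto intro!: refines_unset list_all2_dropI)

lemma num213_le_num123: "refines A B \<Longrightarrow> num213 A s \<le> num123 B s"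
proof (induction s arbitrary: A B)
  case (Cons x s)
  show ?case
  proof (cases x)
    case Rightwards
    show ?thesis
    proof (cases A)
      case Nil
      then show ?thesis using Rightwards Cons by simp
    next
      case (Cons a A')
      then obtain b B' where B: "B = b # B'" and r: "b \<longrightarrow> a" "refines A' B'"
        using Cons.prems by (auto simp: list_all2_Cons1)
      have "(\<Sum>i\<le>lead A'. num213 (a # insert_at i True A') s) \<le>
            (\<Sum>i\<le>lead A'. num123 (b # merge_at i B') s)"
        using r by (intro sum_mono Cons.IH) (simp add: refines_children)
      also have "\<dots> \<le> (\<Sum>i\<le>lead B'. num123 (b # merge_at i B') s)"
        using lead_mono[OF r(2)] by (intro sum_mono2) auto
      finally show ?thesis
        using Cons.IH[of "a # False # A'" "b # False # B'"] r
        by (simp add: Rightwards B \<open>A = a # A'\<close> num213.simps(4) num123.simps(4))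
    qed
  next
    case Upwards
    have "refines (tl A) (tl B)"
      using Cons.prems by (cases A; cases B) auto
    then show ?thesis using Cons.IH Upwards by simp
  qed
qed simp

lemma num213_less_if_lead_less:
  assumes "refines (a # A) (b # B)" "lead A < lead B"
  shows "num213 (a # A) (Rightwards # s) < num123 (b # B) (Rightwards # s)"
proof -
  have r: "b \<longrightarrow> a" "refines A B" using assms by auto
  have "(\<Sum>i\<le>lead A. num213 (a # insert_at i True A) s) \<le>
        (\<Sum>i\<le>lead A. num123 (b # merge_at i B) s)"
    using r by (intro sum_mono num213_le_num123) (simp add: refines_children)
  also have "\<dots> < (\<Sum>i\<le>lead B. num123 (b # merge_at i B) s)"
    using assms(2) num123_pos by (intro sum_strict_mono2[of _ _ "lead B"]) auto
  finally show ?thesis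
    using num213_le_num123[of "a # False # A" "b # False # B" s] r by (simp add: num213.simps(4) num123.simps(4))
qed

lemma num213_less_if_front:
  assumes "refines (a # A) (b # B)"
    and "num213 (a # False # A) s < num123 (b # False # B) s"
  shows "num213 (a # A) (Rightwards # s) < num123 (b # B) (Rightwards # s)"
proof -
  have r: "b \<longrightarrow> a" "refines A B" using assms by auto
  have "(\<Sum>i\<le>lead A. num213 (a # insert_at i True A) s) \<le>
        (\<Sum>i\<le>lead A. num123 (b # merge_at i B) s)"
    using r by (intro sum_mono num213_le_num123) (simp add: refines_children)
  also have "\<dots> \<le> (\<Sum>i\<le>lead B. num123 (b # merge_at i B) s)"
    using lead_mono[OF r(2)] by (intro sum_mono2) auto
  finally show ?thesis using assms(2) by (simp add: num213.simps(4) num123.simps(4))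
qed

lemma num213_less_if_split:
  assumes "refines (a # A) (b # B)" "i \<le> lead A"
    and "num213 (a # insert_at i True A) s < num123 (b # merge_at i B) s"
  shows "num213 (a # A) (Rightwards # s) < num123 (b # B) (Rightwards # s)"
proof -
  have r: "b \<longrightarrow> a" "refines A B" using assms by auto
  have "(\<Sum>i\<le>lead A. num213 (a # insert_at i True A) s) <
        (\<Sum>i\<le>lead A. num123 (b # merge_at i B) s)"
    using r assms by (intro sum_strict_mono_ex1) (auto intro!: num213_le_num123 simp: refines_children)
  also have "\<dots> \<le> (\<Sum>i\<le>lead B. num123 (b # merge_at i B) s)"
    using lead_mono[OF r(2)] by (intro sum_mono2) auto
  finally show ?thesis
    using num213_le_num123[of "a # False # A" "b # False # B" s] r by (simp add: num213.simps(4) num123.simps(4))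
qed

text \<open>
  A strict inequality at all pairs of states of some height persists when a word leading to that height is
  put in front, because the choice to extend the first run is always available.
\<close>

lemma num213_less_prefix:
  assumes "\<And>A B. refines A B \<Longrightarrow> length A = g \<Longrightarrow> num213 A s < num123 B s"
  shows "leads_to h w g \<Longrightarrow> refines A B \<Longrightarrow> length A = h \<Longrightarrow>
           num213 A (w @ s) < num123 B (w @ s)"
proof (induction w arbitrary: h A B)
  case Nil
  then show ?case using assms by simp
next
  case (Cons x w)
  show ?case
  proof (cases x)
    case Upwards
    have "refines (tl A) (tl B)"
      using Cons.prems by (cases A; cases B) auto
    then show ?thesis using Cons.prems Cons.IH[of "h - 1" "tl A" "tl B"] Upwards by simp
  next
    case Rightwards
    show ?thesis
    proof (cases A)
      case Nil
      then show ?thesis using Rightwards Cons by simp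
    next
      case A: (Cons a A')
      then obtain b B' where B: "B = b # B'" using Cons.prems by (auto simp: list_all2_Cons1)
      have "num213 (a # False # A') (w @ s) < num123 (b # False # B') (w @ s)"
        using Cons.prems A B Rightwards by (intro Cons.IH) auto
      then show ?thesis
        using num213_less_if_front[of a A' b B'] Cons.prems A B Rightwards by simp
    qed
  qed
qed

lemma drop_lead: "lead A < length A \<Longrightarrow> \<exists>zs. drop (lead A) A = True # zs"
  by (induction A) auto

text \<open>
  From first runs of equal length \<open>Suc k\<close> the first runs can be brought to length \<open>u\<close>
  before the last step to the right, which then makes both first runs end at row \<open>u\<close> but merges the
  next run only in the second state. After \<open>u\<close> upward steps the first runs have different lengths.
\<close>

lemma num213_less_peak:
  assumes "refines (a # A) (b # B)" "lead A = k" "lead B = k" "k < u" "u \<le> Suc k + r"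
    "u \<le> length A + r"
  shows "num213 (a # A) (replicate (Suc r) Rightwards @ replicate u Upwards @ Rightwards # s) <
         num123 (b # B) (replicate (Suc r) Rightwards @ replicate u Upwards @ Rightwards # s)"
  using assms
proof (induction r arbitrary: A B k)
  case 0
  then have u: "u = Suc k" by simp
  have len: "length A = length B" using 0 list_all2_lengthD by fastforce
  obtain as where as: "drop k A = True # as" using drop_lead[of A] 0 u by auto
  obtain bs where bs: "drop k B = True # bs" using drop_lead[of B] 0 u len by auto
  have dA: "drop u (a # insert_at k True A) = True # True # as"
    using 0 u as lead_le_length[of A] by (simp add: insert_at_def)
  have dB: "drop u (b # merge_at k B) = True # False # bs"
    using 0 u bs lead_le_length[of B] by (simp add: merge_at_def)
  have "refines (drop u (a # insert_at k True A)) (drop u (b # merge_at k B))"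
    using 0 by (intro list_all2_dropI) (auto simp: refines_children)
  then have "num213 (a # insert_at k True A) (replicate u Upwards @ Rightwards # s) <
        num123 (b # merge_at k B) (replicate u Upwards @ Rightwards # s)"
    unfolding num213_ups num123_ups dA dB by (intro num213_less_if_lead_less) auto
  then show ?case
    unfolding replicate_Suc replicate_0 append_Cons append_Nil using 0
    by (intro num213_less_if_split[of _ _ _ _ k]) auto
next
  case (Suc r)
  show ?case
  proof (cases "Suc k < u")
    case True
    have "num213 (a # False # A) (replicate (Suc r) Rightwards @ replicate u Upwards @ Rightwards # s) <
       num123 (b # False # B) (replicate (Suc r) Rightwards @ replicate u Upwards @ Rightwards # s)"
      using Suc.prems True by (intro Suc.IH[of _ _ "Suc k"]) auto
    then show ?thesis
      unfolding replicate_Suc[of "Suc r"] append_Cons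
      by (intro num213_less_if_front Suc.prems)
  next
    case False
    have "num213 (a # insert_at k True A) (replicate (Suc r) Rightwards @ replicate u Upwards @ Rightwards # s) <
       num123 (b # merge_at k B) (replicate (Suc r) Rightwards @ replicate u Upwards @ Rightwards # s)"
      using Suc.prems False
      by (intro Suc.IH[of _ _ k]) (auto simp: refines_children lead_insert_at lead_merge_at)
    then show ?thesis
      unfolding replicate_Suc[of "Suc r"] append_Cons using Suc.prems
      by (intro num213_less_if_split[of _ _ _ _ k]) auto
  qed
qed

lemma word_decomp:
  fixes t :: "step list"
  shows "\<exists>v r u. t = v @ replicate r Rightwards @ replicate u Upwards \<and>
       (v = [] \<or> (r > 0 \<and> (\<exists>v'. v = v' @ [Upwards])))"
proof (induction t rule: rev_induct)
  case Nil
  show ?case by (intro exI[of _ "[]"] exI[of _ 0]) simp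
next
  case (snoc x t)
  then obtain v r u where t: "t = v @ replicate r Rightwards @ replicate u Upwards"
    and v: "v = [] \<or> (r > 0 \<and> (\<exists>v'. v = v' @ [Upwards]))" by blast
  show ?case
  proof (cases x)
    case Upwards
    then have "t @ [x] = v @ replicate r Rightwards @ replicate (Suc u) Upwards"
      using t by (simp add: replicate_append_same)
    then show ?thesis using v by blast
  next
    case Rightwards
    show ?thesis
    proof (cases u)
      case 0
      then have "t @ [x] = v @ replicate (Suc r) Rightwards @ replicate 0 Upwards"
        using t Rightwards by (simp add: replicate_append_same)
      then show ?thesis using v by blast
    next
      case (Suc u')
      have "\<exists>v'. t = v' @ [Upwards]"
        using t unfolding Suc replicate_Suc replicate_append_same[symmetric] by simp
      then have "t @ [x] = t @ replicate 1 Rightwards @ replicate 0 Upwards \<and>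
          (t = [] \<or> (1::nat) > 0 \<and> (\<exists>v'. t = v' @ [Upwards]))"
        using Rightwards by simp
      then show ?thesis by blast
    qed
  qed
qed

lemma leads_to_replicate:
  "leads_to h (replicate r Rightwards) g \<longleftrightarrow> g = h + r"
  by (induction r arbitrary: h) auto

lemma leads_to_replicate_up:
  "leads_to h (replicate r Upwards) g \<longleftrightarrow> h = g + r"
proof (induction r arbitrary: h)
  case (Suc r)
  show ?case unfolding replicate_Suc leads_to.simps Suc by linarith
qed simp

text \<open>
  It suffices to treat the first turn at height at least 2: the steps to the right before its upward
  steps start at height at most 1, where all states have first runs of equal length.
\<close>

lemma num213_less_num123:
  assumes "leads_to 0 (w @ [Upwards]) h" "h \<ge> 2"
  shows "num213 [] (w @ Upwards # Rightwards # s) < num123 [] (w @ Upwards # Rightwards # s)"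
  using assms
proof (induction "length w" arbitrary: w h s rule: less_induct)
  case less
  obtain v r u where t: "w @ [Upwards] = v @ replicate r Rightwards @ replicate u Upwards"
    and v: "v = [] \<or> (r > 0 \<and> (\<exists>v'. v = v' @ [Upwards]))"
    using word_decomp by blast
  have u: "u > 0"
  proof (rule ccontr)
    assume "\<not> 0 < u"
    then have "w @ [Upwards] = v @ replicate r Rightwards" using t by simp
    moreover from this have "r > 0" using v by (cases r) auto
    then obtain r' where "r = Suc r'" by (cases r) auto
    ultimately have "w @ [Upwards] = (v @ replicate r' Rightwards) @ [Rightwards]"
      by (simp add: replicate_append_same)
    then show False by (simp only: append1_eq_conv) simp
  qed
  obtain g where g: "leads_to 0 v g" and gh: "g + r = h + u"
    using less.prems(1) unfolding t leads_to_append leads_to_replicate leads_to_replicate_up by auto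
  have word: "w @ Upwards # Rightwards # s =
    v @ replicate r Rightwards @ replicate u Upwards @ Rightwards # s"
    using arg_cong[OF t, of "\<lambda>z. z @ Rightwards # s"] by simp
  show ?case
  proof (cases "g \<ge> 2")
    case True
    then have "v \<noteq> []" using g by auto
    then obtain v' r' where v': "v = v' @ [Upwards]" and r': "r = Suc r'"
      using v by (metis gr0_implies_Suc)
    have len: "length v' < length w"
      using arg_cong[OF t, of length] u by (simp add: v' r')
    have "num213 [] (v' @ Upwards # Rightwards # replicate r' Rightwards @ replicate u Upwards @ Rightwards # s)
      < num123 [] (v' @ Upwards # Rightwards # replicate r' Rightwards @ replicate u Upwards @ Rightwards # s)"
      using less.hyps[OF len, of g] g v' True by blast
    then show ?thesis unfolding word by (simp add: v' r')
  next
    case False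
    have "num213 A (replicate r Rightwards @ replicate u Upwards @ Rightwards # s) <
          num123 B (replicate r Rightwards @ replicate u Upwards @ Rightwards # s)"
      if AB: "refines A B" "length A = g" for A B
    proof (cases A)
      case Nil
      then have B: "B = []" and g0: "g = 0" using AB by auto
      have "2 \<le> r" using gh g0 less.prems(2) u by simp
      then obtain r' where r': "r = Suc (Suc r')"
        using add_2_eq_Suc le_Suc_ex by blast
      have "num213 [False] (replicate (Suc r') Rightwards @ replicate u Upwards @ Rightwards # s) <
        num123 [False] (replicate (Suc r') Rightwards @ replicate u Upwards @ Rightwards # s)"
        using gh g0 u less.prems(2) r' by (intro num213_less_peak[of _ _ _ _ 0]) auto
      then show ?thesis unfolding r' Nil B by simp
    next
      case (Cons a A')
      then have g1: "g = 1" "A' = []" using AB False by (cases A', auto)+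
      then obtain b where B: "B = [b]" and ba: "b \<longrightarrow> a" using AB Cons
        by (auto simp: list_all2_Cons1)
      obtain r' where r': "r = Suc r'" using gh g1 less.prems(2) u by (cases r) auto
      show ?thesis
        using gh g1 u less.prems(2) ba r' unfolding r' B Cons g1(2)
        by (intro num213_less_peak[of _ _ _ _ 0]) auto
    qed
    then show ?thesis unfolding word
      by (rule num213_less_prefix[OF _ g]) auto
  qed
qed

text \<open>
  As long as all turns from up to right happen at height at most 1, the first runs have equal length
  whenever their length matters.
\<close>

lemma num213_eq_num123:
  assumes "leads_to h s 0" "length A = h" "length B = h"
    and "\<And>w s'. s = w @ Upwards # Rightwards # s' \<Longrightarrow>
           h + count_list w Rightwards \<le> count_list w Upwards + 2"
    and "\<And>s'. s = Rightwards # s' \<Longrightarrow> lead (tl A) = lead (tl B)"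
  shows "num213 A s = num123 B s"
  using assms
proof (induction s arbitrary: h A B)
  case (Cons x s)
  have turns: "Suc h + count_list w Rightwards \<le> count_list w Upwards + 2"
    if "x = Rightwards" "s = w @ Upwards # Rightwards # s'" for w s'
    using Cons.prems(4)[of "x # w" s'] that by simp
  show ?case
  proof (cases x)
    case Rightwards
    show ?thesis
    proof (cases A)
      case Nil
      then have "num213 [False] s = num123 [False] s"
        using Cons.prems Rightwards turns by (intro Cons.IH[of 1]) auto
      then show ?thesis using Nil Cons.prems Rightwards by simp
    next
      case A: (Cons a A')
      then obtain b B' where B: "B = b # B'" using Cons.prems by (cases B) auto
      have l: "lead A' = lead B'" using Cons.prems(5)[of s] Rightwards A B by simp
      have "num213 (a # False # A') s = num123 (b # False # B') s"
        using Cons.prems Rightwards A B l turns by (intro Cons.IH[of "Suc h"]) auto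
      moreover have "num213 (a # insert_at i True A') s = num123 (b # merge_at i B') s"
        if "i \<le> lead A'" for i
        using Cons.prems Rightwards A B l turns that
        by (intro Cons.IH[of "Suc h"]) (auto simp: lead_insert_at lead_merge_at)
      ultimately show ?thesis by (simp add: Rightwards A B l num213.simps(4) num123.simps(4))
    qed
  next
    case Upwards
    have "num213 (tl A) s = num123 (tl B) s"
    proof (rule Cons.IH[of "h - 1"])
      show "leads_to (h - 1) s 0" using Cons.prems Upwards by simp
      show "length (tl A) = h - 1" "length (tl B) = h - 1" using Cons.prems by auto
    next
      fix w s' assume "s = w @ Upwards # Rightwards # s'"
      then show "h - 1 + count_list w Rightwards \<le> count_list w Upwards + 2"
        using Cons.prems(4)[of "x # w" s'] Upwards Cons.prems(1) by simp
    next
      fix s' assume "s = Rightwards # s'"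
      then have "h \<le> 2" using Cons.prems(4)[of "[]" s'] Upwards by simp
      then have "tl (tl A) = []" "tl (tl B) = []" using Cons.prems
        by (auto simp flip: length_0_conv)
      then show "lead (tl (tl A)) = lead (tl (tl B))" by simp
    qed
    then show ?thesis using Upwards by simp
  qed
qed simp

section \<open>Ballot words and the equality of the processes for 123 and 321\<close>

lemma leads_to_shift: "leads_to h w g \<Longrightarrow> leads_to (h + k) w (g + k)"
proof (induction h w g rule: leads_to.induct)
  case (2 h s g)
  then show ?case by (simp add: add.commute)
qed auto

lemma leads_to_last:
  assumes "leads_to h X 0" "X \<noteq> []"
  shows "last X = Upwards"
proof -
  obtain X' x where X: "X = X' @ [x]" using assms(2) by (metis rev_exhaust)
  show ?thesis using assms(1) by (cases x) (auto simp: X leads_to_append)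
qed

lemma leads_to_Suc_cases:
  "leads_to (Suc z) v g \<Longrightarrow>
     (g > 0 \<and> leads_to z v (g - 1)) \<or>
     (\<exists>X Y. v = X @ Upwards # Y \<and> leads_to z X 0 \<and> leads_to 0 Y g)"
proof (induction v arbitrary: z)
  case (Cons x v)
  show ?case
  proof (cases x)
    case Rightwards
    then consider "g > 0 \<and> leads_to (Suc z) v (g - 1)"
      | X Y where "v = X @ Upwards # Y" "leads_to (Suc z) X 0" "leads_to 0 Y g"
      using Cons.IH[of "Suc z"] Cons.prems by auto
    then show ?thesis
    proof cases
      case 2
      then have "x # v = (x # X) @ Upwards # Y" "leads_to z (x # X) 0" using Rightwards by auto
      then show ?thesis using 2 by blast
    qed (use Rightwards in auto)
  next
    case Upwards
    show ?thesis
    proof (cases z)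
      case 0
      then have "x # v = [] @ Upwards # v" "leads_to z [] 0" "leads_to 0 v g"
        using Cons.prems Upwards by auto
      then show ?thesis by blast
    next
      case (Suc z')
      then consider "g > 0 \<and> leads_to z' v (g - 1)"
        | X Y where "v = X @ Upwards # Y" "leads_to z' X 0" "leads_to 0 Y g"
        using Cons.IH[of z'] Cons.prems Upwards by auto
      then show ?thesis
      proof cases
        case 2
        then have "x # v = (x # X) @ Upwards # Y" "leads_to z (x # X) 0"
          using Upwards Suc by auto
        then show ?thesis using 2 by blast
      qed (use Upwards Suc in auto)
    qed
  qed
qed auto

lemma leads_to_last_return:
  "leads_to z w (Suc g) \<Longrightarrow>
     (z > 0 \<and> leads_to (z - 1) w g) \<or>
     (\<exists>X Y. w = X @ Rightwards # Y \<and> leads_to z X 0 \<and> leads_to 0 Y g)"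
proof (induction w arbitrary: z)
  case (Cons x w)
  show ?case
  proof (cases x)
    case Rightwards
    then consider "leads_to z w g"
      | X Y where "w = X @ Rightwards # Y" "leads_to (Suc z) X 0" "leads_to 0 Y g"
      using Cons by fastforce
    then show ?thesis
    proof cases
      case 1
      show ?thesis
      proof (cases z)
        case 0
        then have "x # w = [] @ Rightwards # w" "leads_to z [] 0" "leads_to 0 w g"
          using 1 Rightwards by auto
        then show ?thesis by blast
      qed (use Rightwards 1 in auto)
    next
      case 2
      then have "x # w = (x # X) @ Rightwards # Y" "leads_to z (x # X) 0" using Rightwards by auto
      then show ?thesis using 2 by blast
    qed
  next
    case Upwards
    then obtain z' where z: "z = Suc z'" using Cons.prems by (cases z) auto
    then consider "z' > 0" "leads_to (z' - 1) w g"
      | X Y where "w = X @ Rightwards # Y" "leads_to z' X 0" "leads_to 0 Y g"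
      using Cons.IH[of z'] Cons.prems Upwards by auto
    then show ?thesis
    proof cases
      case 2
      then have "x # w = (x # X) @ Rightwards # Y" "leads_to z (x # X) 0" using Upwards z by auto
      then show ?thesis using 2 by blast
    qed (use Upwards z in auto)
  qed
qed auto

text \<open>
  Ballot words of length \<open>h\<close> that end at level \<open>g\<close>.
\<close>

definition ballots :: "nat \<Rightarrow> nat \<Rightarrow> step list set" where
  "ballots g h = {w. leads_to 0 w g \<and> length w = h}"

text \<open>
  A word that returns to level 0 followed by a ballot word. With a step to the right between them these
  are the ballot words ending at level \<open>Suc g\<close>, split at the last return to 0; with an upward step
  between them they are the words that fall below 0, split at the first fall.
\<close>

definition return_pairs :: "nat \<Rightarrow> nat \<Rightarrow> (step list \<times> step list) set" where
  "return_pairs g h = {(X, Y). leads_to 0 X 0 \<and> leads_to 0 Y g \<and> length X + length Y = h}"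

lemma finite_words: "finite {w :: step list. length w \<le> h}"
proof -
  have "(UNIV :: step set) = {Rightwards, Upwards}" using step.exhaust by auto
  then have "finite (UNIV :: step set)" by (metis finite.emptyI finite.insertI)
  from finite_lists_length_le[OF this] show ?thesis by simp
qed

lemma finite_ballots [simp]: "finite (ballots g h)"
  by (rule finite_subset[OF _ finite_words[of h]]) (auto simp: ballots_def)

lemma finite_return_pairs [simp]: "finite (return_pairs g h)"
  by (rule finite_subset[OF _ finite_cartesian_product[OF finite_words[of h] finite_words[of h]]])
     (auto simp: return_pairs_def)

lemma not_leads_to_below: "leads_to 0 X 0 \<Longrightarrow> \<not> leads_to 0 (X @ Upwards # Y) g"
  by (auto simp: leads_to_append dest: leads_to_unique)

lemma inj_fall: "inj_on (\<lambda>(X, Y). X @ Upwards # Y) (return_pairs g h)"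
proof -
  have *: "us = []" if "X = X' @ us" "us @ Upwards # Y = Upwards # Y'"
    "leads_to 0 X 0" "leads_to 0 X' 0" for X X' us Y Y'
    using that not_leads_to_below by (cases us) auto
  show ?thesis
    by (auto simp: inj_on_def return_pairs_def append_eq_append_conv2) (metis * append_Nil2 list.inject append_Nil)+
qed

lemma inj_rise: "inj_on (\<lambda>(X, Y). X @ Rightwards # Y) (return_pairs g h)"
proof -
  have *: "us = []" if eq: "X = X' @ us" "us @ Rightwards # Y = Rightwards # Y'"
    and l: "leads_to 0 X 0" "leads_to 0 X' 0" "leads_to 0 Y' g" for X X' us Y Y'
  proof (rule ccontr)
    assume "us \<noteq> []"
    then obtain vs where us: "us = Rightwards # vs" and Y': "Y' = vs @ Rightwards # Y"
      using eq(2) by (cases us) auto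
    obtain m where "leads_to 0 vs m" using l(3) unfolding Y' leads_to_append by blast
    then have "leads_to 1 vs (m + 1)" using leads_to_shift[of 0 vs m 1] by simp
    moreover have "leads_to 1 vs 0"
      using l(1,2) unfolding eq us leads_to_append by (auto dest: leads_to_unique)
    ultimately show False by (auto dest: leads_to_unique)
  qed
  show ?thesis
    by (auto simp: inj_on_def return_pairs_def append_eq_append_conv2) (metis * append_Nil2 list.inject append_Nil)+
qed

lemma image_rise: "(\<lambda>(X, Y). X @ Rightwards # Y) ` return_pairs g h = ballots (Suc g) (Suc h)"
proof (intro equalityI subsetI)
  fix w assume "w \<in> (\<lambda>(X, Y). X @ Rightwards # Y) ` return_pairs g h"
  then obtain X Y where "w = X @ Rightwards # Y" "leads_to 0 X 0" "leads_to 0 Y g"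
    "length X + length Y = h"
    by (auto simp: return_pairs_def)
  then show "w \<in> ballots (Suc g) (Suc h)"
    using leads_to_shift[of 0 Y g 1] by (auto simp: ballots_def leads_to_append)
next
  fix w assume "w \<in> ballots (Suc g) (Suc h)"
  then show "w \<in> (\<lambda>(X, Y). X @ Rightwards # Y) ` return_pairs g h"
    using leads_to_last_return[of 0 w g] by (force simp: ballots_def return_pairs_def)
qed

lemma sum_rise:
  "(\<Sum>(X, Y)\<in>return_pairs g h. f (X @ Rightwards # Y)) = (\<Sum>w\<in>ballots (Suc g) (Suc h). f w)"
  unfolding image_rise[symmetric] sum.reindex[OF inj_rise] by (simp add: case_prod_unfold o_def)

text \<open>
  The state that belongs to a word: a new run starts at the second letter of each factor
  ``right, up''. The first argument is the letter before the word.
\<close>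

fun peaks :: "step \<Rightarrow> step list \<Rightarrow> bool list" where
  "peaks p [] = []"
| "peaks p (x # w) = (p = Rightwards \<and> x = Upwards) # peaks x w"

lemma peaks_append: "peaks p (X @ Z) = peaks p X @ peaks (last (p # X)) Z"
  by (induction X arbitrary: p) auto

lemma unset_peaks: "unset (peaks p w) = peaks Upwards w"
  by (cases w) auto

lemma num123_unset: "num123 (unset B) s = num123 B s"
proof (induction s arbitrary: B)
  case (Cons x s)
  have *: "num123 (True # B') s = num123 (False # B') s" for B'
    using Cons.IH[of "True # B'"] by simp
  have "num123 (False # B') (x # s) = num123 (b # B') (x # s)" for b B'
    by (cases x; cases b) (auto simp: num123.simps(4) *)
  then show ?case by (cases B) auto
qed simp

text \<open>
  Turning the first fall below 0 into a rise does not change the runs: the letter before it is an upward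
  step or missing, and the letter after it is a step to the right or missing.
\<close>

lemma peaks_flip:
  assumes "leads_to 0 X 0" "leads_to 0 Y g"
  shows "peaks Upwards (X @ Upwards # Y) = peaks Upwards (X @ Rightwards # Y)"
proof -
  have "last (Upwards # X) = Upwards" using leads_to_last[OF assms(1)] by simp
  moreover have "peaks Upwards Y = peaks Rightwards Y"
  proof (cases Y)
    case (Cons y Y')
    then show ?thesis using assms(2) by (cases y) auto
  qed simp
  ultimately show ?thesis unfolding peaks_append by simp
qed

text \<open>
  The numbers of the 123 process, summed over the states of the ballot words of length \<open>h\<close> ending at
  level \<open>g\<close>.
\<close>

definition ballot_sum :: "nat \<Rightarrow> nat \<Rightarrow> step list \<Rightarrow> nat" where
  "ballot_sum g h s = (\<Sum>w\<in>ballots g h. num123 (peaks Upwards w) s)"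

lemma sum_fall:
  "(\<Sum>(X, Y)\<in>return_pairs g h. num123 (peaks Upwards (X @ Upwards # Y)) s) = ballot_sum (Suc g) (Suc h) s"
  unfolding ballot_sum_def sum_rise[symmetric]
  by (intro sum.cong) (auto simp: return_pairs_def peaks_flip)

lemma leads_to_le: "leads_to 0 w g \<Longrightarrow> g \<le> length w"
proof -
  have "leads_to h w g \<Longrightarrow> g \<le> h + length w" for h
    by (induction h w g rule: leads_to.induct) auto
  from this[of 0] show "leads_to 0 w g \<Longrightarrow> g \<le> length w" by simp
qed

lemma ballots_empty: "h < g \<Longrightarrow> ballots g h = {}"
  using leads_to_le by (fastforce simp: ballots_def)

text \<open>
  Deleting the first letter of a ballot word leaves either a ballot word or a word whose first fall
  below 0 can be flipped.
\<close>

lemma ballot_sum_up: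
  "ballot_sum g (Suc h) (Upwards # s) =
     (if g > 0 then ballot_sum (g - 1) h s else 0) + ballot_sum (Suc g) h s"
proof -
  let ?S = "{v. leads_to 1 v g \<and> length v = h}"
  let ?A = "if g > 0 then ballots (g - 1) h else {}"
  let ?B = "if h > 0 then (\<lambda>(X, Y). X @ Upwards # Y) ` return_pairs g (h - 1) else {}"
  have B: "ballots g (Suc h) = (#) Rightwards ` ?S"
  proof (intro equalityI subsetI)
    fix w assume w: "w \<in> ballots g (Suc h)"
    then obtain x v where "w = x # v" by (cases w) (auto simp: ballots_def)
    then show "w \<in> (#) Rightwards ` ?S" using w by (cases x) (auto simp: ballots_def)
  qed (auto simp: ballots_def)
  have S: "?S = ?A \<union> ?B"
  proof (intro equalityI subsetI)
    fix v assume "v \<in> ?S"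
    then show "v \<in> ?A \<union> ?B"
      using leads_to_Suc_cases[of 0 v g] by (force simp: ballots_def return_pairs_def)
  next
    fix v assume "v \<in> ?A \<union> ?B"
    then show "v \<in> ?S"
      using leads_to_shift[of 0 v "g - 1" 1] leads_to_shift[of 0 _ 0 1]
      by (fastforce simp: ballots_def return_pairs_def leads_to_append split: if_splits)
  qed
  have disj: "?A \<inter> ?B = {}"
    by (auto simp: ballots_def return_pairs_def dest: not_leads_to_below)
  have "ballot_sum g (Suc h) (Upwards # s) = (\<Sum>v\<in>?S. num123 (tl (peaks Upwards (Rightwards # v))) s)"
    unfolding ballot_sum_def B by (subst sum.reindex) (auto simp: o_def)
  also have "\<dots> = (\<Sum>v\<in>?S. num123 (peaks Upwards v) s)"
    by (intro sum.cong refl) (simp add: num123_unset flip: unset_peaks[of Rightwards])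
  also have "\<dots> = (\<Sum>v\<in>?A. num123 (peaks Upwards v) s) + (\<Sum>v\<in>?B. num123 (peaks Upwards v) s)"
    unfolding S using disj by (intro sum.union_disjoint) auto
  also have "(\<Sum>v\<in>?A. num123 (peaks Upwards v) s) = (if g > 0 then ballot_sum (g - 1) h s else 0)"
    by (simp add: ballot_sum_def)
  also have "(\<Sum>v\<in>?B. num123 (peaks Upwards v) s) = ballot_sum (Suc g) h s"
  proof (cases h)
    case 0
    then show ?thesis by (simp add: ballot_sum_def ballots_empty)
  next
    case (Suc h')
    then show ?thesis
      using sum_fall[of s g h'] sum.reindex[OF inj_fall[of g h'], of "\<lambda>v. num123 (peaks Upwards v) s"]
      by (simp add: o_def case_prod_unfold)
  qed
  finally show ?thesis .
qed

text \<open>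
  The number of leading steps to the right.
\<close>

definition rises :: "step list \<Rightarrow> nat" where
  "rises w = length (takeWhile (\<lambda>x. x = Rightwards) w)"

lemma rises_simps [simp]: "rises [] = 0" "rises (Upwards # w) = 0"
  "rises (Rightwards # w) = Suc (rises w)"
  by (auto simp: rises_def)

lemma lead_peaks: "lead (peaks Rightwards w) = rises w"
proof (induction w)
  case (Cons x w)
  then show ?case by (cases x) auto
qed simp

lemma peaks_insert:
  "i \<le> rises w \<Longrightarrow> peaks Rightwards (insert_at i Upwards w) = merge_at i (peaks Rightwards w)"
proof (induction w arbitrary: i)
  case Nil
  then show ?case by (simp add: insert_at_def merge_at_def)
next
  case (Cons x w)
  show ?case
  proof (cases i)
    case 0
    then show ?thesis by (simp add: insert_at_def merge_at_def)
  next
    case (Suc j)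
    then show ?thesis using Cons by (cases x) (auto simp: insert_at_def merge_at_def)
  qed
qed

text \<open>
  In terms of words, a step of the 123 process either puts a step to the right in front or inserts an
  upward step among the leading steps to the right.
\<close>

lemma num123_right:
  assumes "w \<in> ballots g h"
  shows "num123 (peaks Upwards w) (Rightwards # s) =
    num123 (peaks Upwards (Rightwards # w)) s +
    (\<Sum>i<rises w. num123 (peaks Upwards (insert_at (Suc i) Upwards w)) s)"
proof (cases w)
  case (Cons x v)
  then have w: "w = Rightwards # v" using assms by (cases x) (auto simp: ballots_def)
  have "peaks Upwards (insert_at (Suc i) Upwards w) = False # merge_at i (peaks Rightwards v)"
    if "i \<le> rises v" for i
    using peaks_insert[OF that] by (simp add: w insert_at_def)
  then have "(\<Sum>i<rises w. num123 (peaks Upwards (insert_at (Suc i) Upwards w)) s) =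
    (\<Sum>i\<le>rises v. num123 (False # merge_at i (peaks Rightwards v)) s)"
    by (intro sum.cong) (auto simp: w)
  then show ?thesis by (simp add: w num123.simps(4) lead_peaks)
qed simp

lemma rises_split:
  assumes "i < rises w"
  shows "w = replicate (Suc i) Rightwards @ drop (Suc i) w"
    "insert_at (Suc i) Upwards w = replicate (Suc i) Rightwards @ Upwards # drop (Suc i) w"
proof -
  have "take (Suc i) w = replicate (Suc i) Rightwards"
    using assms
  proof (induction w arbitrary: i)
    case (Cons x w)
    show ?case
    proof (cases i)
      case 0
      then show ?thesis using Cons.prems by (cases x) auto
    next
      case (Suc j)
      then show ?thesis using Cons by (cases x) auto
    qed
  qed simp
  then show "w = replicate (Suc i) Rightwards @ drop (Suc i) w"
    "insert_at (Suc i) Upwards w = replicate (Suc i) Rightwards @ Upwards # drop (Suc i) w"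
    unfolding insert_at_def by (metis append_take_drop_id)+
qed

lemma rises_replicate: "i \<le> rises (replicate i Rightwards @ v)"
  by (induction i) auto

lemma leads_to_first_up:
  assumes "leads_to 0 u m" "Upwards \<in> set u"
  shows "\<exists>i y. u = replicate (Suc i) Rightwards @ Upwards # y \<and> leads_to i y m"
proof -
  obtain xs y where u: "u = xs @ Upwards # y" "Upwards \<notin> set xs"
    using assms(2) by (auto dest: split_list_first)
  then have xs: "xs = replicate (length xs) Rightwards"
    by (metis (full_types) replicate_eqI step.exhaust)
  then obtain n where n: "xs = replicate n Rightwards" by blast
  show ?thesis
    using assms(1) unfolding u n by (cases n) (auto simp: leads_to_append leads_to_replicate)
qed

lemma leads_to_only_right: "leads_to h w g \<Longrightarrow> Upwards \<notin> set w \<Longrightarrow> g = h + length w"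
proof (induction w arbitrary: h)
  case (Cons x w)
  then show ?case using Cons.IH[of "Suc h"] by (cases x) auto
qed simp

text \<open>
  The words obtained by inserting an upward step are the ballot words ending one level lower and, after
  a flip, those ballot words ending one level higher that return to 0 after the start. The words ending one level
  higher without such a return arise by a step to the right in front.
\<close>

lemma ballot_sum_right:
  assumes "g \<le> h"
  shows "ballot_sum g h (Rightwards # s) =
     ballot_sum (Suc g) (Suc h) s + (if g > 0 then ballot_sum (g - 1) (Suc h) s else 0)"
proof -
  let ?W = "Sigma (ballots g h) (\<lambda>w. {..<rises w})"
  let ?ins = "\<lambda>(w, i). insert_at (Suc i) Upwards w"
  let ?F = "\<lambda>u. num123 (peaks Upwards u) s"
  let ?A = "if g > 0 then ballots (g - 1) (Suc h) else {}"
  let ?P = "{(X, Y) \<in> return_pairs g h. X \<noteq> []}"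
  let ?B = "(\<lambda>(X, Y). X @ Upwards # Y) ` ?P"
  have inj: "inj_on ?ins ?W"
  proof (rule inj_on_inverseI)
    fix p assume "p \<in> ?W"
    then obtain w i where p: "p = (w, i)" "i < rises w" by auto
    let ?u = "?ins p"
    have u: "?u = replicate (Suc i) Rightwards @ Upwards # drop (Suc i) w"
      using rises_split(2)[OF p(2)] p(1) by simp
    have "takeWhile (\<lambda>x. x = Rightwards) ?u = replicate (Suc i) Rightwards"
      "dropWhile (\<lambda>x. x = Rightwards) ?u = Upwards # drop (Suc i) w"
      unfolding u by (simp_all add: takeWhile_append dropWhile_append)
    then show "(\<lambda>u. (takeWhile (\<lambda>x. x = Rightwards) u @ tl (dropWhile (\<lambda>x. x = Rightwards) u),
        length (takeWhile (\<lambda>x. x = Rightwards) u) - 1)) ?u = p"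
      using rises_split(1)[OF p(2)] p(1) by simp
  qed
  have mem: "replicate (Suc i) Rightwards @ Upwards # y \<in> ?ins ` ?W"
    if "leads_to (Suc i) y g" "length y + Suc i = h" for i y
  proof -
    let ?w = "replicate (Suc i) Rightwards @ y"
    have "?w \<in> ballots g h"
      using that by (auto simp: ballots_def leads_to_append leads_to_replicate simp del: replicate_Suc)
    moreover have "i < rises ?w" using rises_replicate[of "Suc i" y] by simp
    moreover have "?ins (?w, i) = replicate (Suc i) Rightwards @ Upwards # y"
      by (simp add: insert_at_def)
    ultimately show ?thesis by (metis (no_types, lifting) SigmaI image_eqI lessThan_iff)
  qed
  have image: "?ins ` ?W = ?A \<union> ?B"
  proof (intro equalityI subsetI)
    fix u assume "u \<in> ?ins ` ?W"
    then obtain w i where w: "w \<in> ballots g h" "i < rises w" "u = insert_at (Suc i) Upwards w" by auto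
    define y where "y = drop (Suc i) w"
    have w': "w = replicate (Suc i) Rightwards @ y"
      and u: "u = replicate (Suc i) Rightwards @ Upwards # y"
      using rises_split[OF w(2)] w(3) by (auto simp: y_def)
    have y: "leads_to (Suc i) y g" and len: "length y + Suc i = h"
      using w(1) unfolding ballots_def w'
      by (auto simp: leads_to_append leads_to_replicate simp del: replicate_Suc)
    from leads_to_Suc_cases[OF y] show "u \<in> ?A \<union> ?B"
    proof (elim disjE exE conjE)
      assume "0 < g" "leads_to i y (g - 1)"
      then show ?thesis
        using len unfolding u
        by (auto simp: ballots_def leads_to_append leads_to_replicate simp del: replicate_Suc)
    next
      fix X Y assume Y: "y = X @ Upwards # Y" "leads_to i X 0" "leads_to 0 Y g"
      let ?X = "replicate (Suc i) Rightwards @ Upwards # X"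
      have "u = ?X @ Upwards # Y" by (simp add: u Y)
      moreover have "(?X, Y) \<in> ?P"
        using Y len
        by (auto simp: return_pairs_def leads_to_append leads_to_replicate simp del: replicate_Suc)
      ultimately have "u \<in> ?B" by (metis (no_types, lifting) case_prod_conv image_eqI)
      then show ?thesis by (rule UnI2)
    qed
  next
    fix u assume "u \<in> ?A \<union> ?B"
    then show "u \<in> ?ins ` ?W"
    proof
      assume "u \<in> ?A"
      then have g: "g > 0" and u: "leads_to 0 u (g - 1)" "length u = Suc h"
        by (auto simp: ballots_def split: if_splits)
      have "Upwards \<in> set u"
      proof (rule ccontr)
        assume "Upwards \<notin> set u"
        then show False using leads_to_only_right[OF u(1)] u(2) assms g by simp
      qed
      then obtain i y where i: "u = replicate (Suc i) Rightwards @ Upwards # y" "leads_to i y (g - 1)"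
        using leads_to_first_up[OF u(1)] by blast
      have "leads_to (Suc i) y g" using leads_to_shift[OF i(2), of 1] g by simp
      then show ?thesis using mem[of i y] i(1) u(2) by simp
    next
      assume "u \<in> ?B"
      then obtain X Y where u: "u = X @ Upwards # Y" "X \<noteq> []" "leads_to 0 X 0" "leads_to 0 Y g"
        "length X + length Y = h" by (auto simp: return_pairs_def)
      have "Upwards \<in> set X" using leads_to_last[OF u(3,2)] u(2) by (metis last_in_set)
      then obtain i y where i: "X = replicate (Suc i) Rightwards @ Upwards # y" "leads_to i y 0"
        using leads_to_first_up[OF u(3)] by blast
      have "leads_to (Suc i) y 1" using leads_to_shift[OF i(2), of 1] by simp
      then have "leads_to (Suc i) (y @ Upwards # Y) g" using u(4) by (auto simp: leads_to_append)
      then show ?thesis using mem[of i "y @ Upwards # Y"] u(5) by (simp add: u(1) i(1))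
    qed
  qed
  have disj: "?A \<inter> ?B = {}"
    by (auto simp: ballots_def return_pairs_def dest: not_leads_to_below)
  have fin: "finite ?P" by (rule finite_subset[of _ "return_pairs g h"]) auto
  have "ballot_sum g h (Rightwards # s) =
    (\<Sum>w\<in>ballots g h. ?F (Rightwards # w)) + (\<Sum>w\<in>ballots g h. \<Sum>i<rises w. ?F (insert_at (Suc i) Upwards w))"
    unfolding ballot_sum_def by (simp add: num123_right sum.distrib)
  also have "(\<Sum>w\<in>ballots g h. \<Sum>i<rises w. ?F (insert_at (Suc i) Upwards w)) = (\<Sum>u\<in>?ins ` ?W. ?F u)"
    unfolding sum.reindex[OF inj] by (subst sum.Sigma) (auto simp: case_prod_unfold)
  also have "\<dots> = (\<Sum>u\<in>?A. ?F u) + (\<Sum>u\<in>?B. ?F u)"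
    unfolding image using disj fin by (intro sum.union_disjoint) auto
  also have "(\<Sum>u\<in>?A. ?F u) = (if g > 0 then ballot_sum (g - 1) (Suc h) s else 0)"
    by (simp add: ballot_sum_def)
  also have "(\<Sum>u\<in>?B. ?F u) = (\<Sum>(X, Y)\<in>?P. ?F (X @ Upwards # Y))"
    using inj_on_subset[OF inj_fall[of g h], of ?P]
    by (subst sum.reindex) (auto simp: case_prod_unfold)
  also have "(\<Sum>w\<in>ballots g h. ?F (Rightwards # w)) =
    (\<Sum>(X, Y)\<in>{(X, Y) \<in> return_pairs g h. X = []}. ?F (X @ Upwards # Y))"
    by (rule sum.reindex_bij_witness[of _ snd "\<lambda>w. ([], w)"])
       (auto simp: ballots_def return_pairs_def peaks_flip[of "[]", simplified])
  finally have "ballot_sum g h (Rightwards # s) =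
      (\<Sum>(X, Y)\<in>{(X, Y) \<in> return_pairs g h. X = []}. ?F (X @ Upwards # Y)) +
      (\<Sum>(X, Y)\<in>?P. ?F (X @ Upwards # Y)) + (if g > 0 then ballot_sum (g - 1) (Suc h) s else 0)"
    by simp
  also have "(\<Sum>(X, Y)\<in>{(X, Y) \<in> return_pairs g h. X = []}. ?F (X @ Upwards # Y)) +
      (\<Sum>(X, Y)\<in>?P. ?F (X @ Upwards # Y)) = (\<Sum>(X, Y)\<in>return_pairs g h. ?F (X @ Upwards # Y))"
  proof -
    have "return_pairs g h = {(X, Y) \<in> return_pairs g h. X = []} \<union> ?P" by auto
    moreover have "finite {(X, Y) \<in> return_pairs g h. X = []}"
      by (rule finite_subset[of _ "return_pairs g h"]) auto
    moreover have "{(X, Y) \<in> return_pairs g h. X = []} \<inter> ?P = {}" by auto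
    ultimately show ?thesis using sum.union_disjoint fin by (metis (no_types, lifting))
  qed
  finally show ?thesis by (simp add: sum_fall)
qed

text \<open>
  The process for 321: \<open>h\<close> is the number of unfinished rows and \<open>t\<close> the length of the longest
  increasing run at the top.
\<close>

fun num321 :: "nat \<Rightarrow> nat \<Rightarrow> step list \<Rightarrow> nat" where
  "num321 t h [] = 1"
| "num321 t h (Upwards # s) = num321 (min t (h - 1)) (h - 1) s"
| "num321 t h (Rightwards # s) = (\<Sum>p = 1..Suc t. num321 p (Suc h) s)"

text \<open>
  The values of \<open>num321\<close> summed over all lattice paths that start at level \<open>z\<close>, make
  \<open>k\<close> steps to the right (each raising the level by 1) and any number of upward steps (each lowering
  it by 1, never below 0), and stop at the last of these steps to the right; the level reached is the
  length of the top run.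
\<close>

fun below :: "nat \<Rightarrow> nat \<Rightarrow> nat \<Rightarrow> step list \<Rightarrow> nat" where
  "below 0 z h s = num321 z h s"
| "below (Suc k) 0 h s = below k 1 h s"
| "below (Suc k) (Suc z) h s = below k (Suc (Suc z)) h s + below (Suc k) z h s"

text \<open>
  The choice of the new top run in \<open>num321\<close> amounts to one more step to the right due.
\<close>

lemma below_right: "below k z h (Rightwards # s) = below (Suc k) z (Suc h) s"
proof (induction k z h s rule: below.induct)
  case (1 z h s)
  show ?case by (induction z) auto
qed auto

lemma below_up: "z + k < h \<Longrightarrow> below k z h (Upwards # s) = below k z (h - 1) s"
  by (induction k z h s rule: below.induct) (auto simp: min_def)

text \<open>
  Both sides obey the same recursion along the word. Here \<open>k\<close> is the number of upward steps of
  the ballot words.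
\<close>

lemma ballot_sum_eq_below:
  "leads_to (2 * k + z) s 0 \<Longrightarrow> ballot_sum z (2 * k + z) s = below k z (2 * k + z) s"
proof (induction s arbitrary: k z)
  case Nil
  then have "k = 0" "z = 0" by auto
  moreover have "ballots 0 0 = {[]}" by (auto simp: ballots_def)
  ultimately show ?case by (simp add: ballot_sum_def)
next
  case (Cons x s)
  show ?case
  proof (cases x)
    case Rightwards
    show ?thesis
    proof (cases z)
      case 0
      then show ?thesis using Cons.IH[of k 1] Cons.prems Rightwards
        by (simp add: ballot_sum_right below_right)
    next
      case (Suc z')
      then show ?thesis using Cons.IH[of k "Suc z"] Cons.IH[of "Suc k" z'] Cons.prems Rightwards
        by (simp add: ballot_sum_right below_right)
    qed
  next
    case Upwards
    show ?thesis
    proof (cases k)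
      case 0
      then obtain z' where z: "z = Suc z'" using Cons.prems Upwards by (cases z) auto
      have "ballot_sum (Suc (Suc z')) z' s = 0" by (simp add: ballot_sum_def ballots_empty)
      then show ?thesis using Cons.IH[of 0 z'] Cons.prems Upwards 0 z
        by (simp add: ballot_sum_up)
    next
      case (Suc k')
      show ?thesis
      proof (cases z)
        case 0
        then show ?thesis using Cons.IH[of k' 1] Cons.prems Upwards Suc
          by (simp add: ballot_sum_up below_up)
      next
        case (Suc z')
        then show ?thesis
          using Cons.IH[of k' "Suc z"] Cons.IH[of k z'] Cons.prems Upwards \<open>k = Suc k'\<close>
          by (simp add: ballot_sum_up below_up)
      qed
    qed
  qed
qed

lemma num123_eq_num321:
  assumes "leads_to 0 s 0"
  shows "num123 [] s = num321 0 0 s"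
proof -
  have "ballots 0 0 = {[]}" by (auto simp: ballots_def)
  then show ?thesis
    using ballot_sum_eq_below[of 0 0 s] assms by (simp add: ballot_sum_def)
qed

section \<open>Transversals as lists built by inserting columns\<close>

lemma nth_insert_at:
  "v \<le> length L \<Longrightarrow> r \<le> length L \<Longrightarrow>
     insert_at v m L ! r = (if r < v then L ! r else if r = v then m else L ! (r - 1))"
  by (auto simp: insert_at_def nth_append nth_Cons' min_def)

lemma set_insert_at: "set (insert_at v m L) = insert m (set L)"
  by (metis Un_insert_right append_take_drop_id insert_at_def list.simps(15) set_append)

lemma distinct_insert_at: "distinct (insert_at v m L) \<longleftrightarrow> distinct L \<and> m \<notin> set L"
proof -
  have "mset (insert_at v m L) = add_mset m (mset L)"
    unfolding insert_at_def by (metis append_take_drop_id mset.simps(2) mset_append union_mset_add_mset_right)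
  then have "distinct (insert_at v m L) = distinct (m # L)"
    by (metis mset.simps(2) mset_eq_imp_distinct_iff)
  then show ?thesis by auto
qed

lemma drop_insert_at: "y + j \<le> length L \<Longrightarrow> drop y (insert_at (y + j) m L) = insert_at j m (drop y L)"
  by (simp add: insert_at_def drop_take add.commute)

text \<open>
  Partial transversals with columns \<open>1, \<dots>, x\<close>, given by the list of the columns of their points,
  row by row from the bottom; list positions start at 0. Column \<open>j\<close> consists of the cells in the
  rows at position \<open>b j\<close> or higher. The predicate \<open>P\<close> describes the forbidden pattern
  by rows: three such points count as an occurrence if their lowest row meets their rightmost column.
\<close>

definition fillings :: "(nat \<Rightarrow> nat \<Rightarrow> nat \<Rightarrow> bool) \<Rightarrow> (nat \<Rightarrow> nat) \<Rightarrow> nat \<Rightarrow> nat list set" where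
  "fillings P b x = {L. distinct L \<and> set L = {1..x} \<and> (\<forall>r<x. b (L ! r) \<le> r) \<and>
     (\<forall>p q r. p < q \<and> q < r \<and> r < x \<and> P (L ! p) (L ! q) (L ! r) \<longrightarrow>
        p < b (max (max (L ! p) (L ! q)) (L ! r)))}"

lemma finite_fillings [simp]: "finite (fillings P b x)"
  by (rule finite_subset[OF _ finite_permutations_of_set[of "{1..x}"]])
     (auto simp: fillings_def permutations_of_set_def)

lemma length_fillings: "L \<in> fillings P b x \<Longrightarrow> length L = x"
  using distinct_card[of L] by (auto simp: fillings_def)

text \<open>
  No occurrence of the pattern in rows at position \<open>y\<close> or higher uses the row \<open>v\<close>.
\<close>

definition new_ok :: "(nat \<Rightarrow> nat \<Rightarrow> nat \<Rightarrow> bool) \<Rightarrow> nat list \<Rightarrow> nat \<Rightarrow> nat \<Rightarrow> bool" where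
  "new_ok P L v y \<longleftrightarrow> (\<forall>p q r. p < q \<and> q < r \<and> r < length L \<and> v \<in> {p, q, r} \<and>
     P (L ! p) (L ! q) (L ! r) \<longrightarrow> p < y)"

lemma insert_at_fillings:
  assumes b: "mono b" and L: "distinct L" "set L = {1..x}" and v: "v \<le> x" "b (Suc x) \<le> v"
  shows "insert_at v (Suc x) L \<in> fillings P b (Suc x) \<longleftrightarrow>
     L \<in> fillings P b x \<and> new_ok P (insert_at v (Suc x) L) v (b (Suc x))"
proof -
  let ?L = "insert_at v (Suc x) L"
  define sk where "sk r = (if r < v then r else Suc r)" for r :: nat
  have len: "length L = x" using L distinct_card by fastforce
  have nth_sk: "?L ! sk r = L ! r" if "r < x" for r
    using that v len by (auto simp: nth_insert_at sk_def)
  have nth_v: "?L ! v = Suc x" using v len by (simp add: nth_insert_at)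
  have sk_mono: "sk p < sk q \<longleftrightarrow> p < q" for p q by (auto simp: sk_def)
  have sk_bound: "sk r < Suc x \<longleftrightarrow> r < x" for r using v by (auto simp: sk_def)
  have sk_surj: "\<exists>r'. r = sk r'" if "r \<noteq> v" for r
    using that by (intro exI[of _ "if r < v then r else r - 1"]) (auto simp: sk_def)
  have sk_v: "sk r \<noteq> v" for r by (auto simp: sk_def)
  have bound: "L ! r \<le> x" if "r < x" for r using that L len nth_mem by force
  have sk_b: "sk r < b m \<longleftrightarrow> r < b m" if "m \<le> x" for r m
    using monoD[OF b, of m "Suc x"] that v by (auto simp: sk_def)
  have top: "max (max (?L ! p) (?L ! q)) (?L ! r) = Suc x"
    if "v \<in> {p, q, r}" "p \<le> x" "q \<le> x" "r \<le> x" for p q r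
  proof -
    have "?L ! i \<le> Suc x" if "i \<le> x" for i
    proof -
      have "?L ! i \<in> set ?L" using that len by (intro nth_mem) (simp add: length_insert_at)
      then show ?thesis using L by (auto simp: set_insert_at)
    qed
    then have "?L ! p \<le> Suc x" "?L ! q \<le> Suc x" "?L ! r \<le> Suc x" using that by auto
    moreover have "?L ! p = Suc x \<or> ?L ! q = Suc x \<or> ?L ! r = Suc x" using that nth_v by auto
    ultimately show ?thesis by linarith
  qed
  have 1: "distinct ?L" "set ?L = {1..Suc x}"
    using L by (auto simp: distinct_insert_at set_insert_at)
  have 2: "(\<forall>r<Suc x. b (?L ! r) \<le> r) \<longleftrightarrow> (\<forall>r<x. b (L ! r) \<le> r)"
  proof (intro iffI allI impI)
    fix r assume *: "\<forall>r<Suc x. b (?L ! r) \<le> r" and r: "r < x"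
    then have "b (?L ! sk r) \<le> sk r" using sk_bound by blast
    then have "\<not> sk r < b (L ! r)" using nth_sk r by simp
    then show "b (L ! r) \<le> r" using sk_b bound r by (meson not_le)
  next
    fix r assume *: "\<forall>r<x. b (L ! r) \<le> r" and r: "r < Suc x"
    show "b (?L ! r) \<le> r"
    proof (cases "r = v")
      case False
      then obtain r' where r': "r = sk r'" using sk_surj by blast
      then have "r' < x" using r sk_bound by blast
      then have "\<not> sk r' < b (L ! r')" using * sk_b bound by (meson not_le)
      then show ?thesis using r' nth_sk \<open>r' < x\<close> by simp
    qed (use nth_v v in simp)
  qed
  let ?A = "\<lambda>L x p q r. p < q \<and> q < r \<and> r < x \<and> P (L ! p) (L ! q) (L ! r)"
  let ?m = "\<lambda>L p q r. max (max (L ! p) (L ! q)) (L ! r)"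
  have 3: "(\<forall>p q r. ?A ?L (Suc x) p q r \<longrightarrow> p < b (?m ?L p q r)) \<longleftrightarrow>
     (\<forall>p q r. ?A L x p q r \<longrightarrow> p < b (?m L p q r)) \<and> new_ok P ?L v (b (Suc x))"
  proof (intro iffI conjI allI impI)
    fix p q r assume *: "\<forall>p q r. ?A ?L (Suc x) p q r \<longrightarrow> p < b (?m ?L p q r)" and A: "?A L x p q r"
    then have "p < x" "q < x" "r < x" by auto
    moreover from this have "?A ?L (Suc x) (sk p) (sk q) (sk r)"
      using A nth_sk sk_mono sk_bound by simp
    ultimately have "sk p < b (?m L p q r)" using * nth_sk by (metis (no_types, lifting))
    moreover have "?m L p q r \<le> x" using bound A by simp
    ultimately show "p < b (?m L p q r)" using sk_b by blast
  next
    assume *: "\<forall>p q r. ?A ?L (Suc x) p q r \<longrightarrow> p < b (?m ?L p q r)"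
    show "new_ok P ?L v (b (Suc x))"
      unfolding new_ok_def
    proof (intro allI impI, elim conjE)
      fix p q r assume a: "p < q" "q < r" "r < length ?L" "v \<in> {p, q, r}" "P (?L ! p) (?L ! q) (?L ! r)"
      then have "p < b (?m ?L p q r)" using * len by simp
      moreover have "?m ?L p q r = Suc x" using a len by (intro top) auto
      ultimately show "p < b (Suc x)" by simp
    qed
  next
    fix p q r
    assume *: "(\<forall>p q r. ?A L x p q r \<longrightarrow> p < b (?m L p q r)) \<and> new_ok P ?L v (b (Suc x))"
      and A: "?A ?L (Suc x) p q r"
    show "p < b (?m ?L p q r)"
    proof (cases "v \<in> {p, q, r}")
      case True
      have "?m ?L p q r = Suc x" using A True by (intro top) auto
      moreover have "r < length ?L" using A len by (simp add: length_insert_at)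
      then have "p < b (Suc x)" using *[THEN conjunct2] A True unfolding new_ok_def by blast
      ultimately show ?thesis by simp
    next
      case False
      then obtain p' q' r' where sk: "p = sk p'" "q = sk q'" "r = sk r'"
        using sk_surj by (metis insertCI)
      then have A': "p' < q'" "q' < r'" "r' < x" using A sk_mono sk_bound by auto
      then have nth: "?L ! p = L ! p'" "?L ! q = L ! q'" "?L ! r = L ! r'" using sk nth_sk by auto
      then have "p' < b (?m L p' q' r')" using * A A' by auto
      moreover have "?m L p' q' r' \<le> x" using bound A' by simp
      ultimately show ?thesis using sk_b sk nth by simp
    qed
  qed
  show ?thesis unfolding fillings_def using 1 2 3 L by simp
qed

text \<open>
  The number of ways to follow a border word when \<open>x\<close> columns have been inserted and \<open>D\<close>
  lists the unfinished rows, where \<open>ok D j\<close> tells whether the next column may be inserted at position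
  \<open>j\<close> of \<open>D\<close>.
\<close>

fun extensions :: "(nat list \<Rightarrow> nat \<Rightarrow> bool) \<Rightarrow> nat \<Rightarrow> nat list \<Rightarrow> step list \<Rightarrow> nat" where
  "extensions ok x D [] = 1"
| "extensions ok x D (Upwards # s) = extensions ok x (tl D) s"
| "extensions ok x D (Rightwards # s) =
     (\<Sum>j | j \<le> length D \<and> ok D j. extensions ok (Suc x) (insert_at j (Suc x) D) s)"

text \<open>
  The predicate \<open>ok\<close> on the unfinished rows decides whether the insertion of a new rightmost column
  creates an occurrence of \<open>P\<close>.
\<close>

definition local_rule :: "(nat \<Rightarrow> nat \<Rightarrow> nat \<Rightarrow> bool) \<Rightarrow> (nat list \<Rightarrow> nat \<Rightarrow> bool) \<Rightarrow> bool" where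
  "local_rule P ok \<longleftrightarrow> (\<forall>L x y j. (\<forall>c\<in>set L. c \<le> x) \<and> y + j \<le> length L \<longrightarrow>
     new_ok P (insert_at (y + j) (Suc x) L) (y + j) y = ok (drop y L) j)"

lemma sum_extensions_right:
  assumes P: "local_rule P ok" and b: "mono b" "b (Suc x) = y" "y \<le> x"
  shows "(\<Sum>L\<in>fillings P b x. extensions ok x (drop y L) (Rightwards # s)) =
         (\<Sum>L\<in>fillings P b (Suc x). extensions ok (Suc x) (drop y L) s)"
proof -
  let ?J = "\<lambda>L. {j. j \<le> length (drop y L) \<and> ok (drop y L) j}"
  let ?W = "Sigma (fillings P b x) ?J"
  let ?ins = "\<lambda>(L, j). insert_at (y + j) (Suc x) L"
  have fil: "distinct L" "set L = {1..x}" "length L = x" "Suc x \<notin> set L" "\<forall>c\<in>set L. c \<le> x"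
    if "L \<in> fillings P b x" for L
    using that length_fillings[OF that] by (auto simp: fillings_def)
  have inj: "inj_on ?ins ?W"
  proof (rule inj_on_inverseI)
    fix p assume "p \<in> ?W"
    then obtain L j where p: "p = (L, j)" "L \<in> fillings P b x" and j: "j \<le> length (drop y L)"
      by auto
    have len: "y + j \<le> length L" using j fil(3)[OF p(2)] b(3) by simp
    have nin: "Suc x \<notin> set (take (y + j) L)" "Suc x \<notin> set (drop (y + j) L)"
      using fil(4)[OF p(2)] by (auto dest: in_set_takeD in_set_dropD)
    have "filter (\<lambda>c. c \<noteq> Suc x) (take (y + j) L) = take (y + j) L"
      "filter (\<lambda>c. c \<noteq> Suc x) (drop (y + j) L) = drop (y + j) L"
      using nin by (auto simp: filter_id_conv)
    then have "filter (\<lambda>c. c \<noteq> Suc x) (?ins p) = L"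
      unfolding p(1) insert_at_def by simp
    moreover have "takeWhile (\<lambda>c. c \<noteq> Suc x) (?ins p) = take (y + j) L"
      using nin unfolding p(1) insert_at_def by (auto simp: takeWhile_append)
    ultimately show "(\<lambda>L'. (filter (\<lambda>c. c \<noteq> Suc x) L', length (takeWhile (\<lambda>c. c \<noteq> Suc x) L') - y)) (?ins p) = p"
      using p len by simp
  qed
  have image: "?ins ` ?W = fillings P b (Suc x)"
  proof (intro equalityI subsetI)
    fix L' assume "L' \<in> ?ins ` ?W"
    then obtain L j where L: "L \<in> fillings P b x" "j \<le> length (drop y L)" "ok (drop y L) j"
      and L': "L' = insert_at (y + j) (Suc x) L" by auto
    have "y + j \<le> length L" using L(2) fil(3)[OF L(1)] b(3) by simp
    then have "new_ok P L' (y + j) y"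
      using P fil(5)[OF L(1)] L(3) unfolding local_rule_def L' by blast
    then show "L' \<in> fillings P b (Suc x)"
      using insert_at_fillings[OF b(1) fil(1,2)[OF L(1)], of "y + j" P] \<open>y + j \<le> length L\<close>
        fil(3)[OF L(1)] b(2) L(1) unfolding L' by simp
  next
    fix L' assume L': "L' \<in> fillings P b (Suc x)"
    then have dist: "distinct L'" "set L' = {1..Suc x}" by (auto simp: fillings_def)
    then obtain A B where AB: "L' = A @ Suc x # B"
      by (metis atLeastAtMost_iff le_refl split_list Suc_le_mono One_nat_def le0)
    let ?L = "A @ B"
    have set: "set ?L = {1..x}"
    proof -
      have "set ?L = set L' - {Suc x}" using dist(1) unfolding AB by auto
      also have "\<dots> = {1..x}" unfolding dist(2) by auto
      finally show ?thesis .
    qed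
    have dL: "distinct ?L" using dist(1) unfolding AB by auto
    then have len: "length ?L = x" using set distinct_card[of ?L] by simp
    have ins: "L' = insert_at (length A) (Suc x) ?L" unfolding AB insert_at_def by simp
    have "b (L' ! length A) \<le> length A"
    proof -
      have "\<forall>r<Suc x. b (L' ! r) \<le> r" using L' unfolding fillings_def by blast
      moreover have "length A < Suc x" using len by simp
      ultimately show ?thesis by blast
    qed
    then have yA: "y \<le> length A" unfolding AB using b(2) by simp
    then obtain j where j: "length A = y + j" using le_Suc_ex by blast
    have fL: "?L \<in> fillings P b x" and ok: "new_ok P L' (y + j) y"
      using insert_at_fillings[OF b(1) dL set, of "length A" P] L' len yA b(2) unfolding ins j[symmetric]
      by auto
    have "(\<forall>c\<in>set ?L. c \<le> x) \<and> y + j \<le> length ?L" using fil(5)[OF fL] j by simp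
    then have "new_ok P (insert_at (y + j) (Suc x) ?L) (y + j) y = ok (drop y ?L) j"
      using P unfolding local_rule_def by blast
    then have "ok (drop y ?L) j" using ok ins j by simp
    then have "(?L, j) \<in> ?W" using fL j len by auto
    moreover have "L' = ?ins (?L, j)" using ins j by simp
    ultimately show "L' \<in> ?ins ` ?W" by blast
  qed
  have "(\<Sum>L\<in>fillings P b (Suc x). extensions ok (Suc x) (drop y L) s) =
     (\<Sum>(L, j)\<in>?W. extensions ok (Suc x) (drop y (insert_at (y + j) (Suc x) L)) s)"
    unfolding image[symmetric] sum.reindex[OF inj] by (simp add: case_prod_unfold)
  also have "\<dots> = (\<Sum>L\<in>fillings P b x. \<Sum>j\<in>?J L. extensions ok (Suc x) (drop y (insert_at (y + j) (Suc x) L)) s)"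
    by (rule sum.Sigma[symmetric]) auto
  also have "\<dots> = (\<Sum>L\<in>fillings P b x. extensions ok x (drop y L) (Rightwards # s))"
    unfolding extensions.simps using fil(3) b(3)
    by (intro sum.cong refl arg_cong2[of _ _ _ _ "\<lambda>D s. extensions ok (Suc x) D s"] drop_insert_at) auto
  finally show ?thesis by simp
qed

lemma sum_extensions_rights:
  assumes P: "local_rule P ok" and b: "mono b" "\<And>x'. x \<le> x' \<Longrightarrow> x' < x + k \<Longrightarrow> b (Suc x') = y" "y \<le> x"
  shows "(\<Sum>L\<in>fillings P b x. extensions ok x (drop y L) (replicate k Rightwards @ s)) =
         (\<Sum>L\<in>fillings P b (x + k). extensions ok (x + k) (drop y L) s)"
  using b(2,3)
proof (induction k arbitrary: x)
  case (Suc k)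
  have "(\<Sum>L\<in>fillings P b x. extensions ok x (drop y L) (replicate (Suc k) Rightwards @ s)) =
    (\<Sum>L\<in>fillings P b (Suc x). extensions ok (Suc x) (drop y L) (replicate k Rightwards @ s))"
    using sum_extensions_right[OF P b(1), of x y] Suc.prems by simp
  also have "\<dots> = (\<Sum>L\<in>fillings P b (x + Suc k). extensions ok (x + Suc k) (drop y L) s)"
    using Suc.IH[of "Suc x"] Suc.prems by simp
  finally show ?case .
qed simp

text \<open>
  The number of rows, given by their lengths from the bottom to the top, that end before column
  \<open>j\<close>.
\<close>

definition depth :: "nat list \<Rightarrow> nat \<Rightarrow> nat" where
  "depth l j = length (takeWhile (\<lambda>c. c < j) l)"

lemma less_depth_iff:
  assumes "sorted l" "r < length l"
  shows "r < depth l j \<longleftrightarrow> l ! r < j"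
proof
  assume "r < depth l j"
  then show "l ! r < j" unfolding depth_def
    by (metis nth_mem set_takeWhileD takeWhile_nth)
next
  assume *: "l ! r < j"
  show "r < depth l j"
  proof (rule ccontr)
    assume "\<not> r < depth l j"
    then have d: "depth l j \<le> r" by simp
    then have "\<not> l ! depth l j < j"
      using assms(2) nth_length_takeWhile[of "\<lambda>c. c < j" l] unfolding depth_def by auto
    moreover have "l ! depth l j \<le> l ! r" using d assms sorted_nth_mono by blast
    ultimately show False using * by simp
  qed
qed

lemma depth_le: "depth l j \<le> length l"
  by (simp add: depth_def length_takeWhile_le)

lemma mono_depth: "sorted l \<Longrightarrow> mono (depth l)"
proof (rule monoI, rule ccontr)
  fix i j assume l: "sorted l" "i \<le> j" and "\<not> depth l i \<le> depth l j"
  then have "depth l j < depth l i" by simp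
  moreover from this have "depth l j < length l" using depth_le[of l i] by simp
  ultimately show False
    using less_depth_iff[OF l(1), of "depth l j" i] less_depth_iff[OF l(1), of "depth l j" j] l(2) by simp
qed

lemma depth_eqI:
  assumes "sorted l" "y \<le> length l" "\<And>r. r < y \<Longrightarrow> l ! r < j" "y < length l \<Longrightarrow> j \<le> l ! y"
  shows "depth l j = y"
proof (rule antisym)
  show "depth l j \<le> y"
  proof (rule ccontr)
    assume "\<not> depth l j \<le> y"
    then have "y < depth l j" by simp
    moreover from this have "y < length l" using depth_le[of l j] by simp
    ultimately show False using less_depth_iff[OF assms(1), of y j] assms(4) by simp
  qed
  show "y \<le> depth l j"
  proof (rule ccontr)
    assume "\<not> y \<le> depth l j"
    then show False using less_depth_iff[OF assms(1), of "depth l j" j] assms(2,3) by auto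
  qed
qed

lemma sum_extensions_border:
  assumes P: "local_rule P ok" and l: "sorted l" "\<And>r. r < length l \<Longrightarrow> Suc r \<le> l ! r"
  shows "drop y l = cs \<Longrightarrow> y \<le> length l \<Longrightarrow> y \<le> x \<Longrightarrow> (\<And>r. r < y \<Longrightarrow> l ! r \<le> x) \<Longrightarrow>
     (\<And>c. c \<in> set cs \<Longrightarrow> x \<le> c) \<Longrightarrow>
     (\<Sum>L\<in>fillings P (depth l) x. extensions ok x (drop y L) (border_from x cs)) =
     card (fillings P (depth l) (last (x # cs)))"
proof (induction cs arbitrary: x y)
  case Nil
  then show ?case by simp
next
  case (Cons c cs)
  have y: "y < length l" using Cons.prems(1) by (cases "y < length l") auto
  then have c: "l ! y = c" "drop (Suc y) l = cs"
    using Cons.prems(1) Cons_nth_drop_Suc[OF y] by auto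
  have xc: "x \<le> c" using Cons.prems(5) by simp
  have "depth l (Suc x') = y" if "x \<le> x'" "x' < c" for x'
  proof (rule depth_eqI[OF l(1)])
    show "l ! r < Suc x'" if "r < y" for r
      using Cons.prems(4)[OF that] \<open>x \<le> x'\<close> by simp
  qed (use that y c in auto)
  then have "(\<Sum>L\<in>fillings P (depth l) x. extensions ok x (drop y L) (border_from x (c # cs))) =
    (\<Sum>L\<in>fillings P (depth l) c. extensions ok c (drop y L) (Upwards # border_from c cs))"
    using sum_extensions_rights[OF P mono_depth[OF l(1)], of x "c - x" y "Upwards # border_from c cs"]
      xc Cons.prems(3) by simp
  also have "\<dots> = (\<Sum>L\<in>fillings P (depth l) c. extensions ok c (drop (Suc y) L) (border_from c cs))"
    by (simp add: drop_Suc tl_drop)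
  also have "\<dots> = card (fillings P (depth l) (last (c # cs)))"
  proof (rule Cons.IH)
    show "drop (Suc y) l = cs" by (rule c)
    show "Suc y \<le> length l" using y by simp
    show "Suc y \<le> c" using l(2)[OF y] c by simp
    show "l ! r \<le> c" if "r < Suc y" for r
      using that c sorted_nth_mono[OF l(1), of r y] y by simp
    show "c \<le> d" if "d \<in> set cs" for d
    proof -
      have "sorted (c # cs)" using l(1) Cons.prems(1) sorted_wrt_drop by metis
      then show ?thesis using that by simp
    qed
  qed
  finally show ?case by simp
qed

lemma card_fillings_eq_extensions:
  assumes P: "local_rule P ok" and l: "sorted l" "\<And>r. r < length l \<Longrightarrow> Suc r \<le> l ! r"
    "l = [] \<or> last l = length l"
  shows "card (fillings P (depth l) (length l)) = extensions ok 0 [] (border_from 0 l)"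
proof -
  have "fillings P (depth l) 0 = {[]}" by (auto simp: fillings_def)
  then show ?thesis
    using sum_extensions_border[OF P l(1,2), of 0 l 0] l(3) by (auto split: if_splits)
qed

text \<open>
  The case of a pattern whose highest point is in its rightmost column.
\<close>

lemma local_rule_top_last:
  assumes "\<And>u v w. P u v w \<longleftrightarrow> Q u v \<and> max u v < w"
  shows "local_rule P (\<lambda>D j. sorted_wrt (\<lambda>u v. \<not> Q u v) (take j D))"
  unfolding local_rule_def
proof (intro allI impI, elim conjE)
  fix L :: "nat list" and x y j
  assume L: "\<forall>c\<in>set L. c \<le> x" and yj: "y + j \<le> length L"
  let ?L = "insert_at (y + j) (Suc x) L"
  have top: "?L ! (y + j) = Suc x" using yj by (simp add: nth_insert_at)
  have bound: "?L ! i \<le> Suc x" if "i \<le> length L" for i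
  proof -
    have "?L ! i \<in> set ?L" using that by (intro nth_mem) (simp add: length_insert_at)
    then show ?thesis using L by (auto simp: set_insert_at)
  qed
  have small: "?L ! i \<le> x" if "i < y + j" for i
    using that yj L by (simp add: nth_insert_at)
  have "new_ok P ?L (y + j) y \<longleftrightarrow> (\<forall>p q. p < q \<and> q < y + j \<and> Q (L ! p) (L ! q) \<longrightarrow> p < y)"
  proof
    assume *: "new_ok P ?L (y + j) y"
    show "\<forall>p q. p < q \<and> q < y + j \<and> Q (L ! p) (L ! q) \<longrightarrow> p < y"
    proof (intro allI impI, elim conjE)
      fix p q assume pq: "p < q" "q < y + j" "Q (L ! p) (L ! q)"
      then have "P (?L ! p) (?L ! q) (?L ! (y + j))"
        using small[of p] small[of q] top yj by (auto simp: assms nth_insert_at)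
      moreover have "y + j < length ?L" using yj by (simp add: length_insert_at)
      ultimately show "p < y" using * pq unfolding new_ok_def by blast
    qed
  next
    assume *: "\<forall>p q. p < q \<and> q < y + j \<and> Q (L ! p) (L ! q) \<longrightarrow> p < y"
    show "new_ok P ?L (y + j) y"
      unfolding new_ok_def
    proof (intro allI impI, elim conjE)
      fix p q r
      assume a: "p < q" "q < r" "r < length ?L" "y + j \<in> {p, q, r}" "P (?L ! p) (?L ! q) (?L ! r)"
      then have "?L ! r \<le> Suc x" using bound by (simp add: length_insert_at)
      then have "y + j = r" using a top unfolding assms by auto
      then show "p < y" using * a yj by (auto simp: assms nth_insert_at)
    qed
  qed
  also have "\<dots> \<longleftrightarrow> sorted_wrt (\<lambda>u v. \<not> Q u v) (take j (drop y L))"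
  proof
    assume *: "\<forall>p q. p < q \<and> q < y + j \<and> Q (L ! p) (L ! q) \<longrightarrow> p < y"
    show "sorted_wrt (\<lambda>u v. \<not> Q u v) (take j (drop y L))"
      unfolding sorted_wrt_iff_nth_less
    proof (intro allI impI)
      fix p q assume "p < q" "q < length (take j (drop y L))"
      then show "\<not> Q (take j (drop y L) ! p) (take j (drop y L) ! q)"
        using *[rule_format, of "y + p" "y + q"] yj by auto
    qed
  next
    assume *: "sorted_wrt (\<lambda>u v. \<not> Q u v) (take j (drop y L))"
    show "\<forall>p q. p < q \<and> q < y + j \<and> Q (L ! p) (L ! q) \<longrightarrow> p < y"
    proof (intro allI impI, elim conjE, rule ccontr)
      fix p q assume a: "p < q" "q < y + j" "Q (L ! p) (L ! q)" "\<not> p < y"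
      then have "p - y < q - y" "q - y < length (take j (drop y L))" using yj by auto
      then have "\<not> Q (take j (drop y L) ! (p - y)) (take j (drop y L) ! (q - y))"
        using * unfolding sorted_wrt_iff_nth_less by blast
      then show False using a yj by simp
    qed
  qed
  finally show "new_ok P ?L (y + j) y \<longleftrightarrow> sorted_wrt (\<lambda>u v. \<not> Q u v) (take j (drop y L))" .
qed

text \<open>
  The case of a pattern whose lowest point is in its rightmost column.
\<close>

lemma local_rule_top_first:
  assumes "\<And>u v w. P u v w \<longleftrightarrow> Q v w \<and> max v w < u"
  shows "local_rule P (\<lambda>D j. sorted_wrt (\<lambda>u v. \<not> Q u v) (drop j D))"
  unfolding local_rule_def
proof (intro allI impI, elim conjE)
  fix L :: "nat list" and x y j
  assume L: "\<forall>c\<in>set L. c \<le> x" and yj: "y + j \<le> length L"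
  let ?L = "insert_at (y + j) (Suc x) L"
  have top: "?L ! (y + j) = Suc x" using yj by (simp add: nth_insert_at)
  have bound: "?L ! i \<le> Suc x" if "i \<le> length L" for i
  proof -
    have "?L ! i \<in> set ?L" using that by (intro nth_mem) (simp add: length_insert_at)
    then show ?thesis using L by (auto simp: set_insert_at)
  qed
  have small: "L ! i \<le> x" if "i < length L" for i
    using that L by simp
  have "new_ok P ?L (y + j) y \<longleftrightarrow> (\<forall>p q. y + j \<le> p \<and> p < q \<and> q < length L \<longrightarrow> \<not> Q (L ! p) (L ! q))"
  proof
    assume *: "new_ok P ?L (y + j) y"
    show "\<forall>p q. y + j \<le> p \<and> p < q \<and> q < length L \<longrightarrow> \<not> Q (L ! p) (L ! q)"
    proof (intro allI impI notI, elim conjE)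
      fix p q assume pq: "y + j \<le> p" "p < q" "q < length L" "Q (L ! p) (L ! q)"
      then have "P (?L ! (y + j)) (?L ! Suc p) (?L ! Suc q)"
        using small[of p] small[of q] top yj by (auto simp: assms nth_insert_at)
      moreover have "y + j < Suc p" "Suc p < Suc q" "Suc q < length ?L"
        using pq by (auto simp: length_insert_at)
      ultimately have "y + j < y" using * unfolding new_ok_def by blast
      then show False by simp
    qed
  next
    assume *: "\<forall>p q. y + j \<le> p \<and> p < q \<and> q < length L \<longrightarrow> \<not> Q (L ! p) (L ! q)"
    show "new_ok P ?L (y + j) y"
      unfolding new_ok_def
    proof (intro allI impI, elim conjE)
      fix p q r
      assume a: "p < q" "q < r" "r < length ?L" "y + j \<in> {p, q, r}" "P (?L ! p) (?L ! q) (?L ! r)"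
      then have "?L ! p \<le> Suc x" using bound by (simp add: length_insert_at)
      then have p: "y + j = p" using a top unfolding assms by auto
      have r: "r \<le> length L" using a(3) by (simp add: length_insert_at)
      then have "Q (L ! (q - 1)) (L ! (r - 1))" using a p yj by (auto simp: assms nth_insert_at)
      moreover have "y + j \<le> q - 1" "q - 1 < r - 1" "r - 1 < length L" using a p r by auto
      ultimately show "p < y" using * by blast
    qed
  qed
  also have "\<dots> \<longleftrightarrow> sorted_wrt (\<lambda>u v. \<not> Q u v) (drop j (drop y L))"
  proof
    assume *: "\<forall>p q. y + j \<le> p \<and> p < q \<and> q < length L \<longrightarrow> \<not> Q (L ! p) (L ! q)"
    show "sorted_wrt (\<lambda>u v. \<not> Q u v) (drop j (drop y L))"
      unfolding sorted_wrt_iff_nth_less drop_drop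
    proof (intro allI impI)
      fix p q assume "p < q" "q < length (drop (j + y) L)"
      then show "\<not> Q (drop (j + y) L ! p) (drop (j + y) L ! q)"
        using *[rule_format, of "y + j + p" "y + j + q"] yj by (auto simp: add.commute)
    qed
  next
    assume *: "sorted_wrt (\<lambda>u v. \<not> Q u v) (drop j (drop y L))"
    show "\<forall>p q. y + j \<le> p \<and> p < q \<and> q < length L \<longrightarrow> \<not> Q (L ! p) (L ! q)"
    proof (intro allI impI, elim conjE)
      fix p q assume a: "y + j \<le> p" "p < q" "q < length L"
      then have "p - (y + j) < q - (y + j)" "q - (y + j) < length (drop (j + y) L)" by auto
      then have "\<not> Q (drop (j + y) L ! (p - (y + j))) (drop (j + y) L ! (q - (y + j)))"
        using * unfolding sorted_wrt_iff_nth_less drop_drop by blast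
      then show "\<not> Q (L ! p) (L ! q)" using a by (simp add: add.commute)
    qed
  qed
  finally show "new_ok P ?L (y + j) y \<longleftrightarrow> sorted_wrt (\<lambda>u v. \<not> Q u v) (drop j (drop y L))" .
qed

section \<open>The three processes count the avoiders of 213, 123 and 321\<close>

text \<open>
  Marks the entries \<open>d\<close> with \<open>Q p d\<close> for the preceding entry \<open>p\<close>; the first
  argument \<open>p\<close> stands for the entry before the list.
\<close>

fun runs :: "(nat \<Rightarrow> nat \<Rightarrow> bool) \<Rightarrow> nat \<Rightarrow> nat list \<Rightarrow> bool list" where
  "runs Q p [] = []"
| "runs Q p (d # D) = Q p d # runs Q d D"

text \<open>
  The state of the unfinished rows, with the irrelevant first entry set to \<open>False\<close>.
\<close>

definition run_state :: "(nat \<Rightarrow> nat \<Rightarrow> bool) \<Rightarrow> nat list \<Rightarrow> bool list" where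
  "run_state Q D = unset (runs Q 0 D)"

lemma run_state_simps [simp]: "run_state Q [] = []" "run_state Q (d # D) = False # runs Q d D"
  by (simp_all add: run_state_def)

lemma length_runs [simp]: "length (runs Q p D) = length D"
  by (induction D arbitrary: p) auto

lemma unset_runs: "unset (runs Q p D) = run_state Q D"
  by (cases D) auto

lemma num213_unset: "num213 (unset B) s = num213 B s"
proof (induction s arbitrary: B)
  case (Cons x s)
  have *: "num213 (True # B') s = num213 (False # B') s" for B'
    using Cons.IH[of "True # B'"] by simp
  have "num213 (False # B') (x # s) = num213 (b # B') (x # s)" for b B'
    by (cases x; cases b) (auto simp: num213.simps(4) *)
  then show ?case by (cases B) auto
qed simp

lemma num213_run_state: "num213 (run_state Q D) s = num213 (runs Q p D) s"
  using num213_unset[of "runs Q p D" s] by (simp add: unset_runs)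

lemma num123_run_state: "num123 (run_state Q D) s = num123 (runs Q p D) s"
  using num123_unset[of "runs Q p D" s] by (simp add: unset_runs)

definition prefix_free :: "(nat \<Rightarrow> nat \<Rightarrow> bool) \<Rightarrow> nat list \<Rightarrow> nat \<Rightarrow> bool" where
  "prefix_free Q D j \<longleftrightarrow> sorted_wrt (\<lambda>u v. \<not> Q u v) (take j D)"

definition suffix_free :: "(nat \<Rightarrow> nat \<Rightarrow> bool) \<Rightarrow> nat list \<Rightarrow> nat \<Rightarrow> bool" where
  "suffix_free Q D j \<longleftrightarrow> sorted_wrt (\<lambda>u v. \<not> Q u v) (drop j D)"

lemma prefix_free_Suc_iff:
  assumes "transp (\<lambda>u v. \<not> Q u v)"
  shows "i \<le> length D \<Longrightarrow> prefix_free Q (d # D) (Suc i) \<longleftrightarrow> i \<le> lead (runs Q d D)"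
  unfolding prefix_free_def
proof (induction D arbitrary: d i)
  case (Cons e D)
  show ?case
  proof (cases i)
    case (Suc k)
    then have "sorted_wrt (\<lambda>u v. \<not> Q u v) (take (Suc i) (d # e # D)) \<longleftrightarrow>
      \<not> Q d e \<and> sorted_wrt (\<lambda>u v. \<not> Q u v) (take (Suc k) (e # D))"
      using sorted_wrt2[OF assms, of d e "take k D"] by simp
    then show ?thesis using Cons.IH[of k e] Cons.prems Suc by auto
  qed simp
qed simp

lemma sum_prefix_free:
  assumes "transp (\<lambda>u v. \<not> Q u v)"
  shows "(\<Sum>j | j \<le> length (d # D) \<and> prefix_free Q (d # D) j. f j) =
     f 0 + (\<Sum>i\<le>lead (runs Q d D). f (Suc i) :: nat)"
proof -
  have "{j. j \<le> length (d # D) \<and> prefix_free Q (d # D) j} = insert 0 (Suc ` {..lead (runs Q d D)})"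
  proof (intro set_eqI)
    fix j
    show "j \<in> {j. j \<le> length (d # D) \<and> prefix_free Q (d # D) j} \<longleftrightarrow>
        j \<in> insert 0 (Suc ` {..lead (runs Q d D)})"
      using prefix_free_Suc_iff[OF assms, of "j - 1" D d] lead_le_length[of "runs Q d D"]
      by (cases j) (auto simp: prefix_free_def)
  qed
  then show ?thesis by (simp add: sum.reindex)
qed

lemma runs_insert_123:
  "i \<le> lead (runs (<) d D) \<Longrightarrow> d < m \<Longrightarrow> \<forall>c\<in>set D. c < m \<Longrightarrow>
     runs (<) d (insert_at i m D) = merge_at i (runs (<) d D)"
proof (induction D arbitrary: d i)
  case Nil
  then show ?case by (simp add: insert_at_def merge_at_def)
next
  case (Cons e D)
  show ?case
  proof (cases i)
    case 0
    then show ?thesis using Cons.prems by (simp add: insert_at_def merge_at_def)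
  next
    case (Suc k)
    then show ?thesis using Cons by (auto simp: insert_at_def merge_at_def split: if_splits)
  qed
qed

lemma runs_insert_213:
  "i \<le> lead (runs (>) d D) \<Longrightarrow> d < m \<Longrightarrow> \<forall>c\<in>set D. c < m \<Longrightarrow>
     runs (>) d (insert_at i m D) =
       (if i < lead (runs (>) d D) then insert_at (Suc i) True (runs (>) d D) else False # runs (>) d D)"
proof (induction D arbitrary: d i)
  case Nil
  then show ?case by (simp add: insert_at_def)
next
  case (Cons e D)
  show ?case
  proof (cases i)
    case 0
    then show ?thesis using Cons.prems by (auto simp: insert_at_def)
  next
    case (Suc k)
    then show ?thesis using Cons by (auto simp: insert_at_def split: if_splits)
  qed
qed

lemma extensions_123:
  "\<forall>c\<in>set D. c \<le> x \<Longrightarrow> extensions (prefix_free (<)) x D s = num123 (run_state (<) D) s"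
proof (induction s arbitrary: x D)
  case (Cons a s)
  show ?case
  proof (cases a)
    case Upwards
    have "extensions (prefix_free (<)) x (tl D) s = num123 (run_state (<) (tl D)) s"
      using Cons.prems by (intro Cons.IH) (cases D; auto)
    moreover have "num123 (run_state (<) (tl D)) s = num123 (tl (run_state (<) D)) s"
      by (cases D) (auto simp: num123_run_state)
    ultimately show ?thesis using Upwards by simp
  next
    case Rightwards
    show ?thesis
    proof (cases D)
      case Nil
      have "{j. j = 0 \<and> prefix_free (<) [] j} = {0}" by (auto simp: prefix_free_def)
      then show ?thesis using Cons.IH[of "[Suc x]" "Suc x"] Rightwards Nil
        by (simp add: insert_at_def)
    next
      case D: (Cons d D')
      let ?B = "runs (<) d D'"
      have t: "transp (\<lambda>u v :: nat. \<not> u < v)" by (auto simp: transp_def)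
      have "extensions (prefix_free (<)) x D (Rightwards # s) =
        extensions (prefix_free (<)) (Suc x) (Suc x # d # D') s +
        (\<Sum>i\<le>lead ?B. extensions (prefix_free (<)) (Suc x) (d # insert_at i (Suc x) D') s)"
        unfolding D extensions.simps sum_prefix_free[OF t] by (simp add: insert_at_def)
      also have "extensions (prefix_free (<)) (Suc x) (Suc x # d # D') s = num123 (False # False # ?B) s"
        using Cons.IH[of "Suc x # d # D'" "Suc x"] Cons.prems D by fastforce
      also have "(\<Sum>i\<le>lead ?B. extensions (prefix_free (<)) (Suc x) (d # insert_at i (Suc x) D') s) =
        (\<Sum>i\<le>lead ?B. num123 (False # merge_at i ?B) s)"
      proof (intro sum.cong refl)
        fix i assume i: "i \<in> {..lead ?B}"
        have "runs (<) d (insert_at i (Suc x) D') = merge_at i ?B"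
          using i Cons.prems D by (intro runs_insert_123) (auto simp: less_Suc_eq_le)
        then show "extensions (prefix_free (<)) (Suc x) (d # insert_at i (Suc x) D') s =
            num123 (False # merge_at i ?B) s"
          using Cons.IH[of "d # insert_at i (Suc x) D'" "Suc x"] Cons.prems D
          by (fastforce simp: set_insert_at)
      qed
      finally show ?thesis using Rightwards D by (simp add: num123.simps(4))
    qed
  qed
qed simp

lemma extensions_213:
  "\<forall>c\<in>set D. c \<le> x \<Longrightarrow> extensions (prefix_free (>)) x D s = num213 (run_state (>) D) s"
proof (induction s arbitrary: x D)
  case (Cons a s)
  show ?case
  proof (cases a)
    case Upwards
    have "extensions (prefix_free (>)) x (tl D) s = num213 (run_state (>) (tl D)) s"
      using Cons.prems by (intro Cons.IH) (cases D; auto)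
    moreover have "num213 (run_state (>) (tl D)) s = num213 (tl (run_state (>) D)) s"
      by (cases D) (auto simp: num213_run_state)
    ultimately show ?thesis using Upwards by simp
  next
    case Rightwards
    show ?thesis
    proof (cases D)
      case Nil
      have "{j. j = 0 \<and> prefix_free (>) [] j} = {0}" by (auto simp: prefix_free_def)
      then show ?thesis using Cons.IH[of "[Suc x]" "Suc x"] Rightwards Nil
        by (simp add: insert_at_def)
    next
      case D: (Cons d D')
      let ?B = "runs (>) d D'"
      let ?f = "\<lambda>i. num213 (False # insert_at i True ?B) s"
      have t: "transp (\<lambda>u v :: nat. \<not> u > v)" by (auto simp: transp_def)
      have "extensions (prefix_free (>)) x D (Rightwards # s) =
        extensions (prefix_free (>)) (Suc x) (Suc x # d # D') s +
        (\<Sum>i\<le>lead ?B. extensions (prefix_free (>)) (Suc x) (d # insert_at i (Suc x) D') s)"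
        unfolding D extensions.simps sum_prefix_free[OF t] by (simp add: insert_at_def)
      also have "extensions (prefix_free (>)) (Suc x) (Suc x # d # D') s = ?f 0"
      proof -
        have "d < Suc x" using Cons.prems D by simp
        then show ?thesis
          using Cons.IH[of "Suc x # d # D'" "Suc x"] Cons.prems D by (fastforce simp: insert_at_def)
      qed
      also have "(\<Sum>i\<le>lead ?B. extensions (prefix_free (>)) (Suc x) (d # insert_at i (Suc x) D') s) =
        (\<Sum>i\<le>lead ?B. if i < lead ?B then ?f (Suc i) else num213 (False # False # ?B) s)"
      proof (intro sum.cong refl)
        fix i assume i: "i \<in> {..lead ?B}"
        have "runs (>) d (insert_at i (Suc x) D') =
          (if i < lead ?B then insert_at (Suc i) True ?B else False # ?B)"
          using i Cons.prems D by (intro runs_insert_213) (auto simp: less_Suc_eq_le)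
        moreover have "extensions (prefix_free (>)) (Suc x) (d # insert_at i (Suc x) D') s =
            num213 (False # runs (>) d (insert_at i (Suc x) D')) s"
          using Cons.IH[of "d # insert_at i (Suc x) D'" "Suc x"] Cons.prems D
          by (fastforce simp: set_insert_at)
        ultimately show "extensions (prefix_free (>)) (Suc x) (d # insert_at i (Suc x) D') s =
            (if i < lead ?B then ?f (Suc i) else num213 (False # False # ?B) s)"
          by simp
      qed
      also have "\<dots> = (\<Sum>i<lead ?B. ?f (Suc i)) + num213 (False # False # ?B) s"
        unfolding lessThan_Suc_atMost[symmetric] by simp
      finally show ?thesis
        using Rightwards D by (simp add: num213.simps(4) sum.atMost_shift)
    qed
  qed
qed simp

lemma suffix_free_insert:
  fixes D :: "nat list"
  assumes m: "\<forall>c\<in>set D. c < m" and j: "j \<le> length D" and t: "t \<le> length D"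
    and D: "\<And>i. i \<le> length D \<Longrightarrow> suffix_free (>) D i \<longleftrightarrow> length D \<le> i + t"
    and ok: "suffix_free (>) D j" and i: "i \<le> Suc (length D)"
  shows "suffix_free (>) (insert_at j m D) i \<longleftrightarrow>
     Suc (length D) \<le> i + (if j = length D then Suc t else length D - j)"
proof (cases "j = length D")
  case True
  show ?thesis
  proof (cases "i = Suc (length D)")
    case False
    then have "i \<le> length D" using i by simp
    moreover have "\<forall>c\<in>set (drop i D). \<not> m < c" using m in_set_dropD by (metis not_less_iff_gr_or_eq)
    ultimately show ?thesis
      using D[of i] by (auto simp: suffix_free_def insert_at_def True sorted_wrt_append)
  qed (simp add: suffix_free_def insert_at_def True)
next
  case False
  show ?thesis
  proof (cases "i \<le> j")
    case True
    obtain c D' where cD: "drop j D = c # D'" using j False by (cases "drop j D") auto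
    then have "c < m" using m by (metis in_set_dropD list.set_intros(1))
    then have "\<not> suffix_free (>) (insert_at j m D) i"
      using True j cD by (simp add: suffix_free_def insert_at_def sorted_wrt_append)
    then show ?thesis using True j False by auto
  next
    case i': False
    then obtain k where k: "i = Suc (j + k)" using less_imp_Suc_add by (metis not_le)
    have "drop i (insert_at j m D) = drop k (drop j D)" using j by (simp add: insert_at_def k)
    then have "suffix_free (>) (insert_at j m D) i"
      using ok sorted_wrt_drop unfolding suffix_free_def by metis
    then show ?thesis using False j i' by auto
  qed
qed

text \<open>
  The top run of length \<open>t\<close> is characterised by the positions from which on the list increases.
\<close>

lemma extensions_321:
  "\<forall>c\<in>set D. c \<le> x \<Longrightarrow> t \<le> length D \<Longrightarrow>
   (\<And>i. i \<le> length D \<Longrightarrow> suffix_free (>) D i \<longleftrightarrow> length D \<le> i + t) \<Longrightarrow>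
   extensions (suffix_free (>)) x D s = num321 t (length D) s"
proof (induction s arbitrary: x D t)
  case (Cons a s)
  show ?case
  proof (cases a)
    case Upwards
    have "extensions (suffix_free (>)) x (tl D) s = num321 (min t (length D - 1)) (length (tl D)) s"
    proof (rule Cons.IH)
      show "\<forall>c\<in>set (tl D). c \<le> x" using Cons.prems(1) by (cases D) auto
      show "min t (length D - 1) \<le> length (tl D)" by simp
      show "suffix_free (>) (tl D) i \<longleftrightarrow> length (tl D) \<le> i + min t (length D - 1)"
        if "i \<le> length (tl D)" for i
      proof (cases D)
        case (Cons d D')
        then show ?thesis using Cons.prems(3)[of "Suc i"] that by (auto simp: suffix_free_def)
      qed (simp add: suffix_free_def)
    qed
    then show ?thesis using Upwards by simp
  next
    case Rightwards
    let ?h = "length D"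
    let ?t = "\<lambda>j. if j = ?h then Suc t else ?h - j"
    have "extensions (suffix_free (>)) x D (Rightwards # s) =
      (\<Sum>j | j \<le> ?h \<and> suffix_free (>) D j. num321 (?t j) (Suc ?h) s)"
      unfolding extensions.simps
    proof (intro sum.cong refl)
      fix j assume j: "j \<in> {j. j \<le> ?h \<and> suffix_free (>) D j}"
      have "extensions (suffix_free (>)) (Suc x) (insert_at j (Suc x) D) s =
        num321 (?t j) (length (insert_at j (Suc x) D)) s"
      proof (rule Cons.IH)
        show "\<forall>c\<in>set (insert_at j (Suc x) D). c \<le> Suc x"
          using Cons.prems(1) by (auto simp: set_insert_at)
        show "?t j \<le> length (insert_at j (Suc x) D)" using Cons.prems(2) by (auto simp: length_insert_at)
        show "suffix_free (>) (insert_at j (Suc x) D) i \<longleftrightarrow> length (insert_at j (Suc x) D) \<le> i + ?t j"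
          if "i \<le> length (insert_at j (Suc x) D)" for i
          using suffix_free_insert[of D "Suc x" j t i] j Cons.prems that
          by (auto simp: length_insert_at less_Suc_eq_le)
      qed
      then show "extensions (suffix_free (>)) (Suc x) (insert_at j (Suc x) D) s =
        num321 (?t j) (Suc ?h) s" by (simp add: length_insert_at)
    qed
    also have "{j. j \<le> ?h \<and> suffix_free (>) D j} = {?h - t..?h}"
      using Cons.prems(2,3) by auto
    also have "(\<Sum>j\<in>{?h - t..?h}. num321 (?t j) (Suc ?h) s) = (\<Sum>p\<in>{1..Suc t}. num321 p (Suc ?h) s)"
      by (rule sum.reindex_bij_witness[of _ "\<lambda>p. if p = Suc t then ?h else ?h - p" ?t])
         (use Cons.prems(2) in \<open>auto split: if_splits\<close>)
    finally show ?thesis using Rightwards by simp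
  qed
qed simp

lemma mem_cells_iff:
  "(x, y) \<in> cells Y \<longleftrightarrow> 1 \<le> y \<and> y \<le> length Y \<and> 1 \<le> x \<and> x \<le> rev Y ! (y - 1)"
  by (auto simp: cells_def rev_nth)

lemma proper_rows:
  assumes "proper_young_diagram n Y"
  shows "length Y = n" "sorted (rev Y)" "\<And>r. r < n \<Longrightarrow> Suc r \<le> rev Y ! r"
    "rev Y = [] \<or> last (rev Y) = n" "\<And>r. r < n \<Longrightarrow> rev Y ! r \<le> n"
proof -
  show len: "length Y = n" using assms by (simp add: proper_young_diagram_def)
  show "sorted (rev Y)"
    using assms by (simp add: proper_young_diagram_def young_diagram_def sorted_wrt_rev)
  show *: "Suc r \<le> rev Y ! r" if "r < n" for r
  proof -
    have "(Suc r, Suc r) \<in> cells (staircase n)"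
      using that by (simp add: mem_cells_iff staircase_def nth_append)
    then have "(Suc r, Suc r) \<in> cells Y" using assms by (auto simp: proper_young_diagram_def)
    then show ?thesis by (simp add: mem_cells_iff)
  qed
  show **: "rev Y ! r \<le> n" if "r < n" for r
  proof -
    have "(rev Y ! r, Suc r) \<in> cells Y" using that *[OF that] len by (simp add: mem_cells_iff)
    then have "rev Y ! r \<in> fst ` cells Y" by force
    then show ?thesis using assms by (simp add: proper_young_diagram_def)
  qed
  show "rev Y = [] \<or> last (rev Y) = n"
    using *[of "n - 1"] **[of "n - 1"] len by (cases "n = 0") (auto simp: last_conv_nth)
qed

text \<open>
  The list of the columns of a transversal by rows.
\<close>

definition inverse_list :: "nat \<Rightarrow> (nat \<Rightarrow> nat) \<Rightarrow> nat list" where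
  "inverse_list n \<pi> = map (\<lambda>r. inv \<pi> (Suc r)) [0..<n]"

lemma inverse_list_nth:
  "r < n \<Longrightarrow> inverse_list n \<pi> ! r = inv \<pi> (Suc r)"
  by (simp add: inverse_list_def)

lemma set_inverse_list:
  assumes "\<pi> permutes {1..n}"
  shows "set (inverse_list n \<pi>) = {1..n}" "distinct (inverse_list n \<pi>)"
proof -
  have "set (inverse_list n \<pi>) = inv \<pi> ` Suc ` {0..<n}"
    by (simp only: inverse_list_def set_map image_image set_upt)
  also have "Suc ` {0..<n} = {1..n}" by (simp add: atLeastLessThanSuc_atLeastAtMost)
  also have "inv \<pi> ` {1..n} = {1..n}" using permutes_image[OF permutes_inv[OF assms]] .
  finally show "set (inverse_list n \<pi>) = {1..n}" .
  then show "distinct (inverse_list n \<pi>)"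
    by (intro card_distinct) (simp add: inverse_list_def)
qed

lemma inverse_list_bij:
  "bij_betw (inverse_list n) {\<pi>. \<pi> permutes {1..n}} (permutations_of_set {1..n})"
proof -
  have inj: "inj_on (inverse_list n) {\<pi>. \<pi> permutes {1..n}}"
  proof (intro inj_onI)
    fix \<pi> \<rho> assume p: "\<pi> \<in> {\<pi>. \<pi> permutes {1..n}}" "\<rho> \<in> {\<pi>. \<pi> permutes {1..n}}"
      and eq: "inverse_list n \<pi> = inverse_list n \<rho>"
    have "inv \<pi> y = inv \<rho> y" for y
    proof (cases "y \<in> {1..n}")
      case True
      then obtain r where "y = Suc r" "r < n" by (cases y) auto
      then show ?thesis using arg_cong[OF eq, of "\<lambda>L. L ! r"] by (simp add: inverse_list_nth)
    next
      case False
      then show ?thesis using p permutes_inv permutes_not_in by (metis mem_Collect_eq)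
    qed
    then have "inv \<pi> = inv \<rho>" by blast
    then show "\<pi> = \<rho>" using p permutes_inv_inv by (metis mem_Collect_eq)
  qed
  have sub: "inverse_list n ` {\<pi>. \<pi> permutes {1..n}} \<subseteq> permutations_of_set {1..n}"
    using set_inverse_list by (auto simp: permutations_of_set_def)
  have "card (inverse_list n ` {\<pi>. \<pi> permutes {1..n}}) = card (permutations_of_set {1..n})"
    using card_image[OF inj] card_permutations[of "{1..n}" n] by simp
  then have "inverse_list n ` {\<pi>. \<pi> permutes {1..n}} = permutations_of_set {1..n}"
    using sub by (intro card_subset_eq) auto
  then show ?thesis using inj by (simp add: bij_betw_def)
qed

lemma contains_pattern_3:
  "contains_pattern Y \<pi> [a, b, c] \<longleftrightarrow>
     (\<exists>x1 x2 x3. 1 \<le> x1 \<and> x1 < x2 \<and> x2 < x3 \<and> x3 \<le> length Y \<and>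
        order_isomorphic [\<pi> x1, \<pi> x2, \<pi> x3] [a, b, c] \<and>
        (x3, min (min (\<pi> x1) (\<pi> x2)) (\<pi> x3)) \<in> cells Y)"
proof
  assume "contains_pattern Y \<pi> [a, b, c]"
  then obtain xs where xs: "sorted_wrt (<) xs" "set xs \<subseteq> {1..length Y}"
    "order_isomorphic (map \<pi> xs) [a, b, c]" "(last xs, Min (\<pi> ` set xs)) \<in> cells Y"
    by (auto simp: contains_pattern_def)
  then have "length xs = 3" by (simp add: order_isomorphic_def)
  then obtain x1 x2 x3 where "xs = [x1, x2, x3]"
    by (auto simp: numeral_3_eq_3 length_Suc_conv)
  then show "\<exists>x1 x2 x3. 1 \<le> x1 \<and> x1 < x2 \<and> x2 < x3 \<and> x3 \<le> length Y \<and>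
        order_isomorphic [\<pi> x1, \<pi> x2, \<pi> x3] [a, b, c] \<and>
        (x3, min (min (\<pi> x1) (\<pi> x2)) (\<pi> x3)) \<in> cells Y"
    using xs by (intro exI[of _ x1] exI[of _ x2] exI[of _ x3]) (auto simp: min.assoc)
next
  assume "\<exists>x1 x2 x3. 1 \<le> x1 \<and> x1 < x2 \<and> x2 < x3 \<and> x3 \<le> length Y \<and>
        order_isomorphic [\<pi> x1, \<pi> x2, \<pi> x3] [a, b, c] \<and>
        (x3, min (min (\<pi> x1) (\<pi> x2)) (\<pi> x3)) \<in> cells Y"
  then obtain x1 x2 x3 where "1 \<le> x1" "x1 < x2" "x2 < x3" "x3 \<le> length Y"
        "order_isomorphic [\<pi> x1, \<pi> x2, \<pi> x3] [a, b, c]"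
        "(x3, min (min (\<pi> x1) (\<pi> x2)) (\<pi> x3)) \<in> cells Y" by blast
  then show "contains_pattern Y \<pi> [a, b, c]"
    unfolding contains_pattern_def by (intro exI[of _ "[x1, x2, x3]"]) (auto simp: min.assoc)
qed

lemma all_less_3: "(\<forall>i<3. Q i) \<longleftrightarrow> Q 0 \<and> Q 1 \<and> Q (2 :: nat)"
  by (auto simp: numeral_3_eq_3 less_Suc_eq numeral_2_eq_2)

lemma order_isomorphic_3:
  "order_isomorphic [u, v, w] [a, b, c] \<longleftrightarrow>
     (u < v \<longleftrightarrow> a < b) \<and> (v < u \<longleftrightarrow> b < a) \<and> (u < w \<longleftrightarrow> a < c) \<and> (w < u \<longleftrightarrow> c < a) \<and>
     (v < w \<longleftrightarrow> b < c) \<and> (w < v \<longleftrightarrow> c < b)"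
  by (auto simp: order_isomorphic_def all_less_3 numeral_2_eq_2 eval_nat_numeral(3)[symmetric]
      simp flip: numeral_3_eq_3)

lemma contains_213:
  "contains_pattern Y \<pi> [2, 1, 3] \<longleftrightarrow>
     (\<exists>x1 x2 x3. 1 \<le> x1 \<and> x1 < x2 \<and> x2 < x3 \<and> x3 \<le> length Y \<and> \<pi> x2 < \<pi> x1 \<and> \<pi> x1 < \<pi> x3 \<and>
        (x3, \<pi> x2) \<in> cells Y)"
  unfolding contains_pattern_3 order_isomorphic_3
  by (intro ex_cong1) (auto simp: min_def split: if_splits)

lemma contains_123:
  "contains_pattern Y \<pi> [1, 2, 3] \<longleftrightarrow>
     (\<exists>x1 x2 x3. 1 \<le> x1 \<and> x1 < x2 \<and> x2 < x3 \<and> x3 \<le> length Y \<and> \<pi> x1 < \<pi> x2 \<and> \<pi> x2 < \<pi> x3 \<and>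
        (x3, \<pi> x1) \<in> cells Y)"
  unfolding contains_pattern_3 order_isomorphic_3
  by (intro ex_cong1) (auto simp: min_def split: if_splits)

lemma contains_312:
  "contains_pattern Y \<pi> [3, 1, 2] \<longleftrightarrow>
     (\<exists>x1 x2 x3. 1 \<le> x1 \<and> x1 < x2 \<and> x2 < x3 \<and> x3 \<le> length Y \<and> \<pi> x2 < \<pi> x3 \<and> \<pi> x3 < \<pi> x1 \<and>
        (x3, \<pi> x2) \<in> cells Y)"
  unfolding contains_pattern_3 order_isomorphic_3
  by (intro ex_cong1) (auto simp: min_def split: if_splits)

lemma contains_321:
  "contains_pattern Y \<pi> [3, 2, 1] \<longleftrightarrow>
     (\<exists>x1 x2 x3. 1 \<le> x1 \<and> x1 < x2 \<and> x2 < x3 \<and> x3 \<le> length Y \<and> \<pi> x3 < \<pi> x2 \<and> \<pi> x2 < \<pi> x1 \<and>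
        (x3, \<pi> x3) \<in> cells Y)"
  unfolding contains_pattern_3 order_isomorphic_3
  by (intro ex_cong1) (auto simp: min_def split: if_splits)

text \<open>
  An occurrence of the kind that is excluded in \<open>fillings\<close>.
\<close>

definition row_pattern :: "(nat \<Rightarrow> nat \<Rightarrow> nat \<Rightarrow> bool) \<Rightarrow> (nat \<Rightarrow> nat) \<Rightarrow> nat list \<Rightarrow> bool" where
  "row_pattern P b L \<longleftrightarrow> (\<exists>p q r. p < q \<and> q < r \<and> r < length L \<and> P (L ! p) (L ! q) (L ! r) \<and>
     b (max (max (L ! p) (L ! q)) (L ! r)) \<le> p)"

lemma card_avoiders_eq_fillings:
  assumes Y: "proper_young_diagram n Y"
    and pat: "\<And>\<pi>. \<pi> permutes {1..n} \<Longrightarrow>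
       contains_pattern Y \<pi> \<tau> \<longleftrightarrow> row_pattern P (depth (rev Y)) (inverse_list n \<pi>)"
  shows "card (avoiders Y \<tau>) = card (fillings P (depth (rev Y)) n)"
proof -
  note rows = proper_rows[OF Y]
  let ?b = "depth (rev Y)"
  have cell: "(x, Suc r) \<in> cells Y \<longleftrightarrow> ?b x \<le> r" if "r < n" "x \<in> {1..n}" for x r
    using less_depth_iff[OF rows(2), of r x] that rows(1) by (auto simp: mem_cells_iff not_less)
  have trans: "(\<forall>x\<in>{1..n}. (x, \<pi> x) \<in> cells Y) \<longleftrightarrow> (\<forall>r<n. ?b (inverse_list n \<pi> ! r) \<le> r)"
    if p: "\<pi> permutes {1..n}" for \<pi>
  proof
    assume *: "\<forall>x\<in>{1..n}. (x, \<pi> x) \<in> cells Y"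
    show "\<forall>r<n. ?b (inverse_list n \<pi> ! r) \<le> r"
    proof (intro allI impI)
      fix r assume r: "r < n"
      have x: "inv \<pi> (Suc r) \<in> {1..n}" using permutes_in_image[OF permutes_inv[OF p], of "Suc r"] r by auto
      then have "(inv \<pi> (Suc r), Suc r) \<in> cells Y"
        using * permutes_inverses(1)[OF p, of "Suc r"] by metis
      then show "?b (inverse_list n \<pi> ! r) \<le> r" using cell[OF r x] r by (simp add: inverse_list_nth)
    qed
  next
    assume *: "\<forall>r<n. ?b (inverse_list n \<pi> ! r) \<le> r"
    show "\<forall>x\<in>{1..n}. (x, \<pi> x) \<in> cells Y"
    proof
      fix x assume x: "x \<in> {1..n}"
      then have "\<pi> x \<in> {1..n}" using permutes_in_image[OF p] by blast
      then obtain r where r: "\<pi> x = Suc r" "r < n" by (cases "\<pi> x") auto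
      have "inverse_list n \<pi> ! r = x"
        using r permutes_inverses(2)[OF p, of x] by (simp add: inverse_list_nth)
      then show "(x, \<pi> x) \<in> cells Y" using * r cell[OF r(2) x] by auto
    qed
  qed
  have "bij_betw (inverse_list n) {\<pi> \<in> {\<pi>. \<pi> permutes {1..n}}. \<pi> \<in> avoiders Y \<tau>}
     {L \<in> permutations_of_set {1..n}. L \<in> fillings P ?b n}"
  proof (rule bij_betw_Collect[OF inverse_list_bij])
    fix \<pi> assume "\<pi> \<in> {\<pi>. \<pi> permutes {1..n}}"
    then have p: "\<pi> permutes {1..n}" by simp
    have "length (inverse_list n \<pi>) = n" by (simp add: inverse_list_def)
    then show "(inverse_list n \<pi> \<in> fillings P ?b n) = (\<pi> \<in> avoiders Y \<tau>)"
      using set_inverse_list[OF p] trans[OF p] pat[OF p] p rows(1)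
      unfolding avoiders_def transversals_def fillings_def row_pattern_def
      by (auto simp: not_le)
  qed
  moreover have "{\<pi> \<in> {\<pi>. \<pi> permutes {1..n}}. \<pi> \<in> avoiders Y \<tau>} = avoiders Y \<tau>"
    using rows(1) by (auto simp: avoiders_def transversals_def)
  moreover have "{L \<in> permutations_of_set {1..n}. L \<in> fillings P ?b n} = fillings P ?b n"
    by (auto simp: fillings_def permutations_of_set_def)
  ultimately show ?thesis using bij_betw_same_card by metis
qed

lemma inverse_list_surj:
  assumes p: "\<pi> permutes {1..n}" and x: "1 \<le> x" "x \<le> n"
  shows "\<pi> x - 1 < n" "inverse_list n \<pi> ! (\<pi> x - 1) = x" "1 \<le> \<pi> x"
proof -
  have "\<pi> x \<in> {1..n}" using permutes_in_image[OF p] x by auto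
  then show *: "\<pi> x - 1 < n" and "1 \<le> \<pi> x" by auto
  then have "Suc (\<pi> x - 1) = \<pi> x" by simp
  then show "inverse_list n \<pi> ! (\<pi> x - 1) = x"
    using permutes_inverses(2)[OF p, of x] unfolding inverse_list_nth[OF *] by simp
qed

lemma inverse_list_props:
  assumes p: "\<pi> permutes {1..n}" and r: "r < n"
  shows "1 \<le> inverse_list n \<pi> ! r" "inverse_list n \<pi> ! r \<le> n" "\<pi> (inverse_list n \<pi> ! r) = Suc r"
proof -
  have "inverse_list n \<pi> ! r \<in> {1..n}"
    using set_inverse_list(1)[OF p] r by (metis diff_zero inverse_list_def length_map length_upt nth_mem)
  then show "1 \<le> inverse_list n \<pi> ! r" "inverse_list n \<pi> ! r \<le> n" by auto
  show "\<pi> (inverse_list n \<pi> ! r) = Suc r"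
    using permutes_inverses(1)[OF p] r by (simp add: inverse_list_nth)
qed

lemma cell_depth:
  assumes "proper_young_diagram n Y" "r < n" "1 \<le> x"
  shows "(x, Suc r) \<in> cells Y \<longleftrightarrow> depth (rev Y) x \<le> r"
  using less_depth_iff[OF proper_rows(2)[OF assms(1)], of r x] assms proper_rows(1)[OF assms(1)]
  by (auto simp: mem_cells_iff not_less)

lemma row_pattern_iff:
  assumes Y: "proper_young_diagram n Y" and p: "\<pi> permutes {1..n}"
  shows "row_pattern P (depth (rev Y)) (inverse_list n \<pi>) \<longleftrightarrow>
     (\<exists>u v w. {u, v, w} \<subseteq> {1..n} \<and> \<pi> u < \<pi> v \<and> \<pi> v < \<pi> w \<and> P u v w \<and>
        (max (max u v) w, \<pi> u) \<in> cells Y)"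
proof
  let ?L = "inverse_list n \<pi>"
  have len: "length ?L = n" by (simp add: inverse_list_def)
  assume "row_pattern P (depth (rev Y)) ?L"
  then obtain i j k where ijk: "i < j" "j < k" "k < n" "P (?L ! i) (?L ! j) (?L ! k)"
    "depth (rev Y) (max (max (?L ! i) (?L ! j)) (?L ! k)) \<le> i"
    unfolding row_pattern_def len by blast
  have "i < n" "j < n" using ijk by auto
  note s = inverse_list_props[OF p this(1)] inverse_list_props[OF p this(2)]
    inverse_list_props[OF p ijk(3)]
  have "(max (max (?L ! i) (?L ! j)) (?L ! k), Suc i) \<in> cells Y"
    using cell_depth[OF Y \<open>i < n\<close>] ijk(5) s(1) by (simp add: le_max_iff_disj)
  then show "\<exists>u v w. {u, v, w} \<subseteq> {1..n} \<and> \<pi> u < \<pi> v \<and> \<pi> v < \<pi> w \<and> P u v w \<and>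
        (max (max u v) w, \<pi> u) \<in> cells Y"
    using s ijk by (intro exI[of _ "?L ! i"] exI[of _ "?L ! j"] exI[of _ "?L ! k"]) simp
next
  let ?L = "inverse_list n \<pi>"
  have len: "length ?L = n" by (simp add: inverse_list_def)
  assume "\<exists>u v w. {u, v, w} \<subseteq> {1..n} \<and> \<pi> u < \<pi> v \<and> \<pi> v < \<pi> w \<and> P u v w \<and>
        (max (max u v) w, \<pi> u) \<in> cells Y"
  then obtain u v w where uvw: "\<pi> u < \<pi> v" "\<pi> v < \<pi> w" "P u v w"
      "(max (max u v) w, \<pi> u) \<in> cells Y"
    and r: "1 \<le> u" "u \<le> n" "1 \<le> v" "v \<le> n" "1 \<le> w" "w \<le> n" by auto
  note s = inverse_list_surj[OF p r(1,2)] inverse_list_surj[OF p r(3,4)] inverse_list_surj[OF p r(5,6)]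
  have "depth (rev Y) (max (max u v) w) \<le> \<pi> u - 1"
    using cell_depth[OF Y s(1), of "max (max u v) w"] uvw(4) s(3) r(1) by (simp add: le_max_iff_disj)
  then have "P (?L ! (\<pi> u - 1)) (?L ! (\<pi> v - 1)) (?L ! (\<pi> w - 1)) \<and>
      depth (rev Y) (max (max (?L ! (\<pi> u - 1)) (?L ! (\<pi> v - 1))) (?L ! (\<pi> w - 1))) \<le> \<pi> u - 1"
    using uvw(3) unfolding s(2,5,8) by (rule conjI[rotated])
  moreover have "\<pi> u - 1 < \<pi> v - 1" "\<pi> v - 1 < \<pi> w - 1" using uvw s(3,6,9) by linarith+
  ultimately show "row_pattern P (depth (rev Y)) ?L"
    unfolding row_pattern_def len using s(7) by blast
qed

lemma leads_to_border_from:
  assumes l: "sorted l" "\<And>r. r < length l \<Longrightarrow> Suc r \<le> l ! r"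
  shows "drop y l = cs \<Longrightarrow> y \<le> length l \<Longrightarrow> y \<le> x \<Longrightarrow> (\<And>c. c \<in> set cs \<Longrightarrow> x \<le> c) \<Longrightarrow>
     leads_to (x - y) (border_from x cs) (last (x # cs) - length l)"
proof (induction cs arbitrary: x y)
  case Nil
  then show ?case by simp
next
  case (Cons c cs)
  have y: "y < length l" using Cons.prems(1) by (cases "y < length l") auto
  then have c: "l ! y = c" "drop (Suc y) l = cs"
    using Cons.prems(1) Cons_nth_drop_Suc[OF y] by auto
  have xc: "x \<le> c" using Cons.prems(4) by simp
  have yc: "Suc y \<le> c" using l(2)[OF y] c by simp
  have "sorted (c # cs)" using l(1) Cons.prems(1) sorted_wrt_drop by metis
  then have "leads_to (c - Suc y) (border_from c cs) (last (c # cs) - length l)"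
    using y yc c by (intro Cons.IH) auto
  then show ?case
    using xc yc Cons.prems(3) by (auto simp: leads_to_append leads_to_replicate)
qed

lemma leads_to_border:
  assumes "proper_young_diagram n Y"
  shows "leads_to 0 (border Y) 0"
  using leads_to_border_from[of "rev Y" 0 "rev Y" 0] proper_rows[OF assms]
  by (auto simp: border_def split: if_splits)

lemma card_avoiders_213:
  assumes Y: "proper_young_diagram n Y"
  shows "card (avoiders Y [2, 1, 3]) = num213 [] (border Y)"
proof -
  note rows = proper_rows[OF Y]
  let ?P = "\<lambda>u v w :: nat. v < u \<and> max u v < w"
  have rule: "local_rule ?P (prefix_free (>))"
    using local_rule_top_last[of ?P "(>)"] unfolding prefix_free_def by simp
  have "contains_pattern Y \<pi> [2, 1, 3] \<longleftrightarrow> row_pattern ?P (depth (rev Y)) (inverse_list n \<pi>)"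
    if p: "\<pi> permutes {1..n}" for \<pi>
    unfolding row_pattern_iff[OF Y p] contains_213 rows(1)
  proof
    assume "\<exists>x1 x2 x3. 1 \<le> x1 \<and> x1 < x2 \<and> x2 < x3 \<and> x3 \<le> n \<and> \<pi> x2 < \<pi> x1 \<and> \<pi> x1 < \<pi> x3 \<and>
        (x3, \<pi> x2) \<in> cells Y"
    then show "\<exists>u v w. {u, v, w} \<subseteq> {1..n} \<and> \<pi> u < \<pi> v \<and> \<pi> v < \<pi> w \<and> ?P u v w \<and>
        (max (max u v) w, \<pi> u) \<in> cells Y"
      by (elim exE, rename_tac x1 x2 x3, rule_tac x = x2 in exI, rule_tac x = x1 in exI,
          rule_tac x = x3 in exI) (auto simp: max_def)
  next
    assume "\<exists>u v w. {u, v, w} \<subseteq> {1..n} \<and> \<pi> u < \<pi> v \<and> \<pi> v < \<pi> w \<and> ?P u v w \<and>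
        (max (max u v) w, \<pi> u) \<in> cells Y"
    then show "\<exists>x1 x2 x3. 1 \<le> x1 \<and> x1 < x2 \<and> x2 < x3 \<and> x3 \<le> n \<and> \<pi> x2 < \<pi> x1 \<and> \<pi> x1 < \<pi> x3 \<and>
        (x3, \<pi> x2) \<in> cells Y"
      by (elim exE, rename_tac u v w, rule_tac x = v in exI, rule_tac x = u in exI,
          rule_tac x = w in exI) (auto simp: max_def)
  qed
  from card_avoiders_eq_fillings[OF Y this] card_fillings_eq_extensions[OF rule, of "rev Y"] rows
  show ?thesis by (simp add: border_def extensions_213)
qed

lemma card_avoiders_123:
  assumes Y: "proper_young_diagram n Y"
  shows "card (avoiders Y [1, 2, 3]) = num123 [] (border Y)"
proof -
  note rows = proper_rows[OF Y]
  let ?P = "\<lambda>u v w :: nat. u < v \<and> max u v < w"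
  have rule: "local_rule ?P (prefix_free (<))"
    using local_rule_top_last[of ?P "(<)"] unfolding prefix_free_def by simp
  have "contains_pattern Y \<pi> [1, 2, 3] \<longleftrightarrow> row_pattern ?P (depth (rev Y)) (inverse_list n \<pi>)"
    if p: "\<pi> permutes {1..n}" for \<pi>
    unfolding row_pattern_iff[OF Y p] contains_123 rows(1)
    by (intro ex_cong1) (auto simp: max_def)
  from card_avoiders_eq_fillings[OF Y this] card_fillings_eq_extensions[OF rule, of "rev Y"] rows
  show ?thesis by (simp add: border_def extensions_123)
qed

lemma card_avoiders_321:
  assumes Y: "proper_young_diagram n Y"
  shows "card (avoiders Y [3, 2, 1]) = num321 0 0 (border Y)"
proof -
  note rows = proper_rows[OF Y]
  let ?P = "\<lambda>u v w :: nat. w < v \<and> max v w < u"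
  have rule: "local_rule ?P (suffix_free (>))"
    using local_rule_top_first[of ?P "(>)"] unfolding suffix_free_def by simp
  have "contains_pattern Y \<pi> [3, 2, 1] \<longleftrightarrow> row_pattern ?P (depth (rev Y)) (inverse_list n \<pi>)"
    if p: "\<pi> permutes {1..n}" for \<pi>
    unfolding row_pattern_iff[OF Y p] contains_321 rows(1)
  proof
    assume "\<exists>x1 x2 x3. 1 \<le> x1 \<and> x1 < x2 \<and> x2 < x3 \<and> x3 \<le> n \<and> \<pi> x3 < \<pi> x2 \<and> \<pi> x2 < \<pi> x1 \<and>
        (x3, \<pi> x3) \<in> cells Y"
    then show "\<exists>u v w. {u, v, w} \<subseteq> {1..n} \<and> \<pi> u < \<pi> v \<and> \<pi> v < \<pi> w \<and> ?P u v w \<and>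
        (max (max u v) w, \<pi> u) \<in> cells Y"
      by (elim exE, rename_tac x1 x2 x3, rule_tac x = x3 in exI, rule_tac x = x2 in exI,
          rule_tac x = x1 in exI) (auto simp: max_def)
  next
    assume "\<exists>u v w. {u, v, w} \<subseteq> {1..n} \<and> \<pi> u < \<pi> v \<and> \<pi> v < \<pi> w \<and> ?P u v w \<and>
        (max (max u v) w, \<pi> u) \<in> cells Y"
    then show "\<exists>x1 x2 x3. 1 \<le> x1 \<and> x1 < x2 \<and> x2 < x3 \<and> x3 \<le> n \<and> \<pi> x3 < \<pi> x2 \<and> \<pi> x2 < \<pi> x1 \<and>
        (x3, \<pi> x3) \<in> cells Y"
      by (elim exE, rename_tac u v w, rule_tac x = w in exI, rule_tac x = v in exI,
          rule_tac x = u in exI) (auto simp: max_def)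
  qed
  from card_avoiders_eq_fillings[OF Y this] card_fillings_eq_extensions[OF rule, of "rev Y"] rows
  show ?thesis by (simp add: border_def extensions_321[of "[]" 0 0, simplified] suffix_free_def)
qed

section \<open>Left-to-right maxima and the avoiders of 321 and 312\<close>

text \<open>
  The left-to-right maxima with their columns.
\<close>

definition record_points :: "nat \<Rightarrow> (nat \<Rightarrow> nat) \<Rightarrow> (nat \<times> nat) set" where
  "record_points n \<pi> = {(x, \<pi> x) |x. x \<in> {1..n} \<and> (\<forall>w\<in>{1..<x}. \<pi> w < \<pi> x)}"

lemma record_value: "(x, v) \<in> record_points n \<pi> \<Longrightarrow> \<pi> x = v"
  by (auto simp: record_points_def)

lemma record_before:
  assumes "x \<in> {1..n}" "inj \<pi>" "(x, \<pi> x) \<notin> record_points n \<pi>"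
  shows "\<exists>s. 1 \<le> s \<and> s < x \<and> \<pi> x < \<pi> s \<and> (s, \<pi> s) \<in> record_points n \<pi>"
proof -
  have "\<exists>s. s \<in> {1..<x} \<and> \<pi> x < \<pi> s"
  proof -
    obtain w where w: "w \<in> {1..<x}" "\<not> \<pi> w < \<pi> x" using assms by (auto simp: record_points_def)
    moreover have "\<pi> w \<noteq> \<pi> x" using w(1) by (simp add: inj_eq[OF assms(2)])
    ultimately show ?thesis by (intro exI[of _ w]) auto
  qed
  then obtain s where s: "s \<in> {1..<x} \<and> \<pi> x < \<pi> s"
    and least: "\<And>w. w < s \<Longrightarrow> \<not> (w \<in> {1..<x} \<and> \<pi> x < \<pi> w)"
    using exists_least_iff[of "\<lambda>s. s \<in> {1..<x} \<and> \<pi> x < \<pi> s"] by blast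
  have "\<pi> w < \<pi> s" if "w \<in> {1..<s}" for w
    using least[of w] that s by auto
  then have "(s, \<pi> s) \<in> record_points n \<pi>" using s assms(1) by (auto simp: record_points_def)
  then show ?thesis using s by (intro exI[of _ s]) auto
qed

lemma record_points_transpose_subset:
  assumes "1 \<le> x1" "x1 < x2" "x2 < x3" "\<pi> x2 < \<pi> x1" "\<pi> x3 < \<pi> x1"
  shows "record_points n \<pi> \<subseteq> record_points n (\<pi> \<circ> transpose x2 x3)"
proof
  fix P assume "P \<in> record_points n \<pi>"
  then obtain x where P: "P = (x, \<pi> x)" "x \<in> {1..n}" and rec: "\<And>w. w \<in> {1..<x} \<Longrightarrow> \<pi> w < \<pi> x"
    by (auto simp: record_points_def)
  have "x \<noteq> x2" "x \<noteq> x3" using rec[of x1] assms by auto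
  then have x: "(\<pi> \<circ> transpose x2 x3) x = \<pi> x" by simp
  have "(\<pi> \<circ> transpose x2 x3) w < \<pi> x" if w: "w \<in> {1..<x}" for w
  proof (cases "w \<in> {x2, x3}")
    case True
    then have "\<pi> x1 < \<pi> x" using rec[of x1] w assms by auto
    then show ?thesis using True assms by auto
  qed (use rec[OF w] in auto)
  then show "P \<in> record_points n (\<pi> \<circ> transpose x2 x3)"
    unfolding record_points_def using P x by auto
qed

lemma record_points_transpose:
  assumes "1 \<le> x1" "x1 < x2" "x2 < x3" "\<pi> x2 < \<pi> x1" "\<pi> x3 < \<pi> x1"
  shows "record_points n (\<pi> \<circ> transpose x2 x3) = record_points n \<pi>"
proof
  show "record_points n \<pi> \<subseteq> record_points n (\<pi> \<circ> transpose x2 x3)"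
    by (rule record_points_transpose_subset[OF assms])
  have "record_points n (\<pi> \<circ> transpose x2 x3) \<subseteq>
      record_points n ((\<pi> \<circ> transpose x2 x3) \<circ> transpose x2 x3)"
    using assms by (intro record_points_transpose_subset[of x1]) auto
  then show "record_points n (\<pi> \<circ> transpose x2 x3) \<subseteq> record_points n \<pi>"
    by (simp add: comp_assoc)
qed

lemma cells_closed:
  assumes "proper_young_diagram n Y" "(x, y) \<in> cells Y" "1 \<le> x'" "x' \<le> x" "y \<le> y'" "y' \<le> n"
  shows "(x', y') \<in> cells Y"
proof -
  have "rev Y ! (y - 1) \<le> rev Y ! (y' - 1)"
    using assms proper_rows(1,2)[OF assms(1)] by (intro sorted_nth_mono) (auto simp: mem_cells_iff)
  then show ?thesis using assms proper_rows(1)[OF assms(1)] by (auto simp: mem_cells_iff)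
qed

lemma transversals_transpose:
  assumes Y: "proper_young_diagram n Y" and p: "\<pi> \<in> transversals Y"
    and x: "1 \<le> x2" "x2 < x3" "x3 \<le> n" and c: "(x3, min (\<pi> x2) (\<pi> x3)) \<in> cells Y"
  shows "\<pi> \<circ> transpose x2 x3 \<in> transversals Y"
proof -
  note n = proper_rows(1)[OF Y]
  have perm: "\<pi> permutes {1..n}" and cell: "\<And>x. x \<in> {1..n} \<Longrightarrow> (x, \<pi> x) \<in> cells Y"
    using p n by (auto simp: transversals_def)
  have "transpose x2 x3 permutes {1..n}" using x by (intro permutes_swap_id) auto
  then have "\<pi> \<circ> transpose x2 x3 permutes {1..n}" using perm by (rule permutes_compose)
  moreover have "(x, (\<pi> \<circ> transpose x2 x3) x) \<in> cells Y" if "x \<in> {1..n}" for x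
  proof -
    have le: "\<pi> x2 \<le> n" "\<pi> x3 \<le> n"
      using permutes_in_image[OF perm, of x2] permutes_in_image[OF perm, of x3] x by auto
    have "(x3, \<pi> x2) \<in> cells Y" "(x2, \<pi> x3) \<in> cells Y"
      using cells_closed[OF Y c] x le by auto
    then show ?thesis using cell[OF that] by (cases "x = x2"; cases "x = x3") auto
  qed
  ultimately show ?thesis using n by (simp add: transversals_def)
qed

lemma finite_transversals: "finite (transversals Y)"
  by (rule finite_subset[OF _ finite_permutations[of "{1..length Y}"]]) (auto simp: transversals_def)

text \<open>
  A potential that grows whenever an inversion is removed by exchanging two entries.
\<close>

definition weight :: "nat \<Rightarrow> (nat \<Rightarrow> nat) \<Rightarrow> nat" where
  "weight n \<pi> = (\<Sum>x\<in>{1..n}. x * \<pi> x)"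

lemma weight_transpose:
  assumes "1 \<le> x2" "x2 < x3" "x3 \<le> n" "\<pi> x2 < \<pi> x3"
  shows "weight n (\<pi> \<circ> transpose x2 x3) < weight n \<pi>"
proof -
  have split: "weight n \<rho> = x2 * \<rho> x2 + (x3 * \<rho> x3 + (\<Sum>x\<in>{1..n} - {x2} - {x3}. x * \<rho> x))" for \<rho>
    unfolding weight_def using assms by (subst sum.remove[of _ x2], simp, simp, subst sum.remove[of _ x3]) auto
  have "(\<Sum>x\<in>{1..n} - {x2} - {x3}. x * (\<pi> \<circ> transpose x2 x3) x) = (\<Sum>x\<in>{1..n} - {x2} - {x3}. x * \<pi> x)"
    by (intro sum.cong) auto
  moreover have "x2 * \<pi> x3 + x3 * \<pi> x2 < x2 * \<pi> x2 + x3 * \<pi> x3"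
  proof -
    obtain d where d: "x3 = x2 + Suc d" using assms(2) less_imp_Suc_add by fastforce
    obtain e where e: "\<pi> x3 = \<pi> x2 + Suc e" using assms(4) less_imp_Suc_add by fastforce
    show ?thesis unfolding e unfolding d by (simp add: algebra_simps)
  qed
  ultimately show ?thesis unfolding split[of "\<pi> \<circ> transpose x2 x3"] split[of \<pi>] by simp
qed

lemma exists_312_avoider:
  assumes Y: "proper_young_diagram n Y" and p: "\<pi> \<in> transversals Y"
  shows "\<exists>\<rho>\<in>avoiders Y [3, 1, 2]. record_points n \<rho> = record_points n \<pi>"
proof -
  let ?S = "{\<rho> \<in> transversals Y. record_points n \<rho> = record_points n \<pi>}"
  obtain \<rho> where \<rho>: "\<rho> \<in> ?S" and least: "\<And>\<sigma>. \<sigma> \<in> ?S \<Longrightarrow> weight n \<rho> \<le> weight n \<sigma>"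
    using ex_has_least_nat[of "\<lambda>\<rho>. \<rho> \<in> ?S" \<pi> "weight n"] p by blast
  have "\<not> contains_pattern Y \<rho> [3, 1, 2]"
  proof
    assume "contains_pattern Y \<rho> [3, 1, 2]"
    then obtain x1 x2 x3 where x: "1 \<le> x1" "x1 < x2" "x2 < x3" "x3 \<le> n" "\<rho> x2 < \<rho> x3" "\<rho> x3 < \<rho> x1"
      "(x3, \<rho> x2) \<in> cells Y"
      unfolding contains_312 proper_rows(1)[OF Y] by blast
    have "\<rho> \<circ> transpose x2 x3 \<in> ?S"
      using transversals_transpose[OF Y, of \<rho> x2 x3] record_points_transpose[of x1 x2 x3 \<rho> n] x \<rho>
      by (auto simp: min_def)
    then show False using least weight_transpose[of x2 x3 n \<rho>] x by fastforce
  qed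
  then show ?thesis using \<rho> by (intro bexI[of _ \<rho>]) (auto simp: avoiders_def)
qed

lemma exists_321_avoider:
  assumes Y: "proper_young_diagram n Y" and p: "\<pi> \<in> transversals Y"
  shows "\<exists>\<rho>\<in>avoiders Y [3, 2, 1]. record_points n \<rho> = record_points n \<pi>"
proof -
  let ?S = "{\<rho> \<in> transversals Y. record_points n \<rho> = record_points n \<pi>}"
  have fin: "finite (weight n ` ?S)" and ne: "weight n ` ?S \<noteq> {}"
    using finite_transversals[of Y] p by auto
  obtain \<rho> where \<rho>: "\<rho> \<in> ?S" "weight n \<rho> = Max (weight n ` ?S)"
    using Max_in[OF fin ne] by (metis (no_types, lifting) imageE)
  then have greatest: "weight n \<sigma> \<le> weight n \<rho>" if "\<sigma> \<in> ?S" for \<sigma>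
    using Max_ge[OF fin, of "weight n \<sigma>"] that by simp
  have "\<not> contains_pattern Y \<rho> [3, 2, 1]"
  proof
    assume "contains_pattern Y \<rho> [3, 2, 1]"
    then obtain x1 x2 x3 where x: "1 \<le> x1" "x1 < x2" "x2 < x3" "x3 \<le> n" "\<rho> x3 < \<rho> x2" "\<rho> x2 < \<rho> x1"
      "(x3, \<rho> x3) \<in> cells Y"
      unfolding contains_321 proper_rows(1)[OF Y] by blast
    have "\<rho> \<circ> transpose x2 x3 \<in> ?S"
      using transversals_transpose[OF Y, of \<rho> x2 x3] record_points_transpose[of x1 x2 x3 \<rho> n] x \<rho>
      by (auto simp: min_def)
    moreover have "weight n ((\<rho> \<circ> transpose x2 x3) \<circ> transpose x2 x3) < weight n (\<rho> \<circ> transpose x2 x3)"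
      using x by (intro weight_transpose) auto
    ultimately show False using greatest by (fastforce simp: comp_assoc)
  qed
  then show ?thesis using \<rho> by (intro bexI[of _ \<rho>]) (auto simp: avoiders_def)
qed

text \<open>
  At the first column where two 321-avoiders with the same left-to-right maxima differ, the one with the
  larger entry meets the smaller entry later, and a left-to-right maximum in front completes a 321.
\<close>

lemma record_points_321_less:
  assumes Y: "proper_young_diagram n Y"
    and p: "\<pi> \<in> avoiders Y [3, 2, 1]" "\<rho> \<in> avoiders Y [3, 2, 1]"
    and rec: "record_points n \<pi> = record_points n \<rho>"
    and x: "x \<in> {1..n}" "\<pi> x < \<rho> x" and agree: "\<And>w. w < x \<Longrightarrow> \<pi> w = \<rho> w"
  shows False
proof -
  note n = proper_rows(1)[OF Y]
  have perm: "\<pi> permutes {1..n}" "\<rho> permutes {1..n}"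
    and cell: "\<And>x. x \<in> {1..n} \<Longrightarrow> (x, \<rho> x) \<in> cells Y"
    using p n by (auto simp: avoiders_def transversals_def)
  have "(x, \<rho> x) \<notin> record_points n \<rho>" using rec x(2) record_value by (metis less_irrefl)
  then obtain t where t: "1 \<le> t" "t < x" "\<rho> x < \<rho> t"
    using record_before[OF x(1)] permutes_inj[OF perm(2)] by blast
  define w where "w = inv \<rho> (\<pi> x)"
  have w: "\<rho> w = \<pi> x" using permutes_inverses(1)[OF perm(2)] by (simp add: w_def)
  have "w \<in> {1..n}"
    using permutes_in_image[OF perm(1), of x] permutes_in_image[OF perm(2), of w] x(1) w by simp
  have "w \<noteq> x" using w x(2) by auto
  moreover have "\<not> w < x"
  proof
    assume "w < x"
    then have "\<pi> w = \<pi> x" using agree w by simp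
    then show False using \<open>w < x\<close> by (simp add: inj_eq[OF permutes_inj[OF perm(1)]])
  qed
  ultimately have "x < w" by simp
  then have "contains_pattern Y \<rho> [3, 2, 1]"
    unfolding contains_321 n using t x w \<open>w \<in> {1..n}\<close> cell[of w]
    by (intro exI[of _ t] exI[of _ x] exI[of _ w]) auto
  then show False using p by (auto simp: avoiders_def)
qed

lemma inj_on_record_points_321:
  assumes Y: "proper_young_diagram n Y"
  shows "inj_on (record_points n) (avoiders Y [3, 2, 1])"
proof (rule inj_onI, rule ccontr)
  fix \<pi> \<rho> assume p: "\<pi> \<in> avoiders Y [3, 2, 1]" "\<rho> \<in> avoiders Y [3, 2, 1]"
    and rec: "record_points n \<pi> = record_points n \<rho>" and "\<pi> \<noteq> \<rho>"
  then obtain x where x: "\<pi> x \<noteq> \<rho> x" and agree: "\<And>w. w < x \<Longrightarrow> \<pi> w = \<rho> w"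
    using exists_least_iff[of "\<lambda>x. \<pi> x \<noteq> \<rho> x"] by blast
  have "\<pi> permutes {1..n}" "\<rho> permutes {1..n}"
    using p proper_rows(1)[OF Y] by (auto simp: avoiders_def transversals_def)
  then have "x \<in> {1..n}" using x by (metis permutes_not_in)
  then show False
    using record_points_321_less[OF Y p rec] record_points_321_less[OF Y p(2,1) rec[symmetric]] x agree
    by (metis linorder_neqE_nat)
qed

lemma card_321_less_312_iff:
  assumes Y: "proper_young_diagram n Y"
  shows "card (avoiders Y [3, 2, 1]) < card (avoiders Y [3, 1, 2]) \<longleftrightarrow>
     \<not> inj_on (record_points n) (avoiders Y [3, 1, 2])"
proof -
  let ?f = "record_points n"
  have fin: "finite (avoiders Y [3, 1, 2])"
    by (rule finite_subset[OF _ finite_transversals[of Y]]) (auto simp: avoiders_def)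
  have sub: "avoiders Y \<tau> \<subseteq> transversals Y" for \<tau> by (auto simp: avoiders_def)
  \<comment> \<open>both kinds of avoiders realise the left-to-right maxima of all transversals\<close>
  have "?f ` avoiders Y \<tau> = ?f ` transversals Y"
    if ex: "\<And>\<pi>. \<pi> \<in> transversals Y \<Longrightarrow> \<exists>\<rho>\<in>avoiders Y \<tau>. ?f \<rho> = ?f \<pi>" for \<tau>
  proof
    show "?f ` avoiders Y \<tau> \<subseteq> ?f ` transversals Y" using sub by (rule image_mono)
    show "?f ` transversals Y \<subseteq> ?f ` avoiders Y \<tau>"
    proof
      fix R assume "R \<in> ?f ` transversals Y"
      then obtain \<pi> where "\<pi> \<in> transversals Y" "R = ?f \<pi>" by blast
      then show "R \<in> ?f ` avoiders Y \<tau>" using ex[of \<pi>] by (metis imageI)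
    qed
  qed
  then have "?f ` avoiders Y [3, 1, 2] = ?f ` avoiders Y [3, 2, 1]"
    using exists_312_avoider[OF Y] exists_321_avoider[OF Y] by metis
  then have "card (avoiders Y [3, 2, 1]) = card (?f ` avoiders Y [3, 1, 2])"
    using card_image[OF inj_on_record_points_321[OF Y]] by simp
  moreover have "card (?f ` avoiders Y [3, 1, 2]) \<le> card (avoiders Y [3, 1, 2])"
    using fin by (rule card_image_le)
  ultimately show ?thesis using inj_on_iff_eq_card[OF fin, of ?f] by linarith
qed

text \<open>
  For row lengths \<open>l\<close> from the bottom to the top: some row in position \<open>k\<close> is shorter
  than the next one and exceeds its row number \<open>Suc k\<close> by at least \<open>m\<close>.
\<close>

definition corner_excess :: "nat list \<Rightarrow> nat \<Rightarrow> bool" where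
  "corner_excess l m \<longleftrightarrow> (\<exists>k. Suc k < length l \<and> l ! k < l ! Suc k \<and> Suc k + m \<le> l ! k)"

text \<open>
  Row \<open>r\<close> is the lowest one in which the transversals differ. The three columns that make the excess
  at least 3 are \<open>q\<close> and the columns \<open>s\<close> and \<open>t\<close> of two left-to-right maxima, where
  \<open>s < p < t < q\<close>.
\<close>

lemma corner_of_two_312_avoiders:
  assumes Y: "proper_young_diagram n Y"
    and p: "\<pi> \<in> avoiders Y [3, 1, 2]" "\<rho> \<in> avoiders Y [3, 1, 2]"
    and rec: "record_points n \<pi> = record_points n \<rho>"
    and r: "\<pi> p = r" "\<rho> q = r" "p < q" and agree: "\<And>x. \<pi> x < r \<Longrightarrow> \<pi> x = \<rho> x"
  shows "corner_excess (rev Y) 3"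
proof -
  note rows = proper_rows[OF Y]
  let ?l = "rev Y"
  have perm: "\<pi> permutes {1..n}" "\<rho> permutes {1..n}"
    and cell: "\<And>x. x \<in> {1..n} \<Longrightarrow> (x, \<pi> x) \<in> cells Y" "\<And>x. x \<in> {1..n} \<Longrightarrow> (x, \<rho> x) \<in> cells Y"
    and av: "\<not> contains_pattern Y \<pi> [3, 1, 2]"
    using p rows(1) by (auto simp: avoiders_def transversals_def)
  note inj = permutes_inj[OF perm(1)] permutes_inj[OF perm(2)]
  have avoid: False if "1 \<le> x1" "x1 < x2" "x2 < x3" "x3 \<le> n" "\<pi> x2 < \<pi> x3" "\<pi> x3 < \<pi> x1"
      "(x3, \<pi> x2) \<in> cells Y" for x1 x2 x3
    using av that unfolding contains_312 rows(1) by blast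
  have pq: "p \<in> {1..n}" "q \<in> {1..n}"
  proof -
    have "\<pi> q \<noteq> \<rho> q" "\<pi> p \<noteq> \<rho> p" using r inj by (metis injD less_irrefl)+
    then show "p \<in> {1..n}" "q \<in> {1..n}" using perm by (metis permutes_not_in)+
  qed
  have agree': "\<pi> x = \<rho> x" if "\<rho> x < r" for x
  proof -
    obtain z where z: "\<pi> z = \<rho> x" using permutes_surj[OF perm(1)] by (metis surjD)
    then have "\<rho> z = \<rho> x" using agree[of z] that by simp
    then show ?thesis using z by (simp add: inj_eq[OF inj(2)])
  qed
  have fresh: "(x, \<pi> x) \<notin> record_points n \<pi>" "(x, \<rho> x) \<notin> record_points n \<rho>" if "\<pi> x \<noteq> \<rho> x" for x
    using that rec record_value by metis+
  \<comment> \<open>some column up to \<open>p\<close> has in \<open>\<rho>\<close> a value that \<open>\<pi>\<close> puts to the right of \<open>p\<close>\<close>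
  have "\<exists>h\<in>{1..p}. \<rho> h \<notin> \<pi> ` {1..p}"
  proof (rule ccontr)
    assume "\<not> ?thesis"
    then have sub: "\<rho> ` {1..p} \<subseteq> \<pi> ` {1..p}" by auto
    have "card (\<rho> ` {1..p}) = card (\<pi> ` {1..p})"
      using inj by (simp add: card_image inj_on_subset)
    then have "\<rho> ` {1..p} = \<pi> ` {1..p}" using sub by (intro card_subset_eq) auto
    moreover have "r \<in> \<pi> ` {1..p}" using pq(1) r(1) by auto
    ultimately obtain x where "x \<in> {1..p}" "\<rho> x = r" by (metis imageE)
    then have "x = q" using r(2) inj_eq[OF inj(2), of x q] by simp
    then show False using \<open>x \<in> {1..p}\<close> r(3) by simp
  qed
  then obtain h where h: "h \<in> {1..p}" "\<rho> h \<notin> \<pi> ` {1..p}" by blast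
  define a where "a = \<rho> h"
  define g where "g = inv \<pi> a"
  have g: "\<pi> g = a" using permutes_inverses(1)[OF perm(1)] by (simp add: g_def)
  have a: "a \<in> {1..n}" using permutes_in_image[OF perm(2), of h] h(1) pq by (auto simp: a_def)
  have gn: "g \<in> {1..n}" using permutes_in_image[OF perm(1), of g] a g by simp
  have gp: "p < g" using h(2) g gn unfolding a_def[symmetric] by (metis atLeastAtMost_iff image_eqI not_le)
  have hne: "\<pi> h \<noteq> \<rho> h" using h by (metis image_eqI)
  have ra: "r < a"
  proof -
    have "a \<noteq> r" using r(2,3) h(1) inj_eq[OF inj(2), of h q] by (auto simp: a_def)
    moreover have "\<not> a < r" using agree'[of h] hne by (auto simp: a_def)
    ultimately show ?thesis by simp
  qed
  have "h \<in> {1..n}" using h(1) pq(1) by auto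
  from record_before[OF this inj(2) fresh(2)[OF hne]]
  obtain s where s: "1 \<le> s" "s < h" "a < \<rho> s" "(s, \<rho> s) \<in> record_points n \<rho>"
    by (auto simp: a_def)
  have s\<pi>: "\<pi> s = \<rho> s" using s(4) rec record_value by metis
  have sp: "s < p" using s(2) h(1) by simp
  \<comment> \<open>the entries in columns \<open>s < p < g\<close> are ordered as 312 in \<open>\<pi>\<close>\<close>
  have out: "(g, r) \<notin> cells Y"
    using avoid[of s p g] s s\<pi> sp gp gn g ra r by auto
  define b where "b = \<pi> q"
  have qne: "\<pi> q \<noteq> \<rho> q" using r inj(1) by (metis injD less_irrefl)
  have rb: "r < b"
    using agree[of q] qne r(2) unfolding b_def by (metis linorder_neqE_nat)
  have pne: "\<pi> p \<noteq> \<rho> p" using r inj(2) by (metis injD less_irrefl)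
  have qr: "(q, r) \<in> cells Y" using cell(2)[OF pq(2)] r(2) by simp
  from record_before[OF pq(2) inj(1) fresh(1)[OF qne]]
  obtain t where t: "1 \<le> t" "t < q" "b < \<pi> t" "(t, \<pi> t) \<in> record_points n \<pi>"
    by (auto simp: b_def)
  have "t \<noteq> p" using t(4) fresh(1)[OF pne] by auto
  moreover have "\<not> t < p"
    using avoid[of t p q] t r pq qr rb by (auto simp: b_def)
  ultimately have tp: "p < t" by simp
  have ab: "a < b"
  proof (rule ccontr)
    assume "\<not> a < b"
    then have "\<pi> q < \<pi> s" using s(3) s\<pi> by (simp add: b_def)
    then show False using avoid[of s p q] s(1) sp r pq qr rb by (auto simp: b_def)
  qed
  \<comment> \<open>the border turns between rows \<open>r\<close> and \<open>a\<close>\<close>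
  have r1: "1 \<le> r" using permutes_in_image[OF perm(1), of p] pq r(1) by auto
  have qlr: "q \<le> ?l ! (r - 1)" using qr by (simp add: mem_cells_iff)
  have lrg: "?l ! (r - 1) < g"
    using out gn r1 ra a rows(1) by (auto simp: mem_cells_iff)
  have gla: "g \<le> ?l ! (a - 1)" using cell(1)[OF gn] g by (simp add: mem_cells_iff)
  define k where "k = (LEAST i. g \<le> ?l ! i)"
  have k: "g \<le> ?l ! k" "k \<le> a - 1" "\<And>i. i < k \<Longrightarrow> ?l ! i < g"
  proof -
    show "g \<le> ?l ! k" unfolding k_def by (rule LeastI[of "\<lambda>i. g \<le> ?l ! i", OF gla])
    show "k \<le> a - 1" unfolding k_def by (rule Least_le[of "\<lambda>i. g \<le> ?l ! i", OF gla])
    show "?l ! i < g" if "i < k" for i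
      using not_less_Least[of i "\<lambda>i. g \<le> ?l ! i"] that unfolding k_def not_le by blast
  qed
  have kn: "k < n" using k(2) a by auto
  have "r - 1 < k"
  proof (rule ccontr)
    assume "\<not> r - 1 < k"
    then have "?l ! k \<le> ?l ! (r - 1)"
      using rows(1,2) r1 ra a by (intro sorted_nth_mono) auto
    then show False using k(1) lrg by simp
  qed
  then obtain j where j: "k = Suc j" "r - 1 \<le> j" by (cases k) auto
  have jn: "Suc j < n" using kn j by simp
  have X: "q \<le> ?l ! j"
    using qlr sorted_nth_mono[OF rows(2), of "r - 1" j] j(2) jn rows(1) by simp
  have ja: "Suc j < a" using k(2) j(1) a by auto
  \<comment> \<open>the rows up to the turn and three higher ones have their points in the first \<open>?l ! j\<close> columns\<close>
  have "{1..Suc j} \<union> {\<pi> s, \<pi> t, \<pi> q} \<subseteq> \<pi> ` {1..?l ! j}"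
  proof
    fix v assume "v \<in> {1..Suc j} \<union> {\<pi> s, \<pi> t, \<pi> q}"
    then consider "v \<in> {1..Suc j}" | "v = \<pi> s" | "v = \<pi> t" | "v = \<pi> q" by auto
    then show "v \<in> \<pi> ` {1..?l ! j}"
    proof cases
      case 1
      define x where "x = inv \<pi> v"
      have x: "\<pi> x = v" using permutes_inverses(1)[OF perm(1)] by (simp add: x_def)
      have "x \<in> {1..n}" using permutes_in_image[OF perm(1), of x] 1 x jn by auto
      then have "1 \<le> x" "x \<le> ?l ! (v - 1)" using cell(1)[of x] x by (auto simp: mem_cells_iff)
      moreover have "?l ! (v - 1) \<le> ?l ! j"
        using 1 jn rows(1,2) by (intro sorted_nth_mono) auto
      ultimately show ?thesis using x by auto
    qed (use X s(1) sp tp t r(3) pq in auto)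
  qed
  then have "card ({1..Suc j} \<union> {\<pi> s, \<pi> t, \<pi> q}) \<le> card (\<pi> ` {1..?l ! j})"
    by (intro card_mono) auto
  also have "\<dots> \<le> ?l ! j" using card_image_le[of "{1..?l ! j}" \<pi>] by simp
  also have "card ({1..Suc j} \<union> {\<pi> s, \<pi> t, \<pi> q}) = Suc j + 3"
  proof -
    have "\<pi> s \<noteq> \<pi> t" "\<pi> s \<noteq> \<pi> q" "\<pi> t \<noteq> \<pi> q"
      using sp tp t(2) by (auto simp: inj_eq[OF inj(1)])
    then have "card {\<pi> s, \<pi> t, \<pi> q} = 3" by simp
    moreover have "{1..Suc j} \<inter> {\<pi> s, \<pi> t, \<pi> q} = {}"
      using ja ab s(3) s\<pi> t(3) by (auto simp: b_def)
    ultimately show ?thesis by (subst card_Un_disjoint) auto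
  qed
  finally have "Suc j + 3 \<le> ?l ! j" .
  moreover have "?l ! j < ?l ! Suc j" using k(1) k(3)[of j] j(1) by auto
  ultimately show ?thesis unfolding corner_excess_def using jn rows(1) by auto
qed

lemma corner_if_not_inj:
  assumes Y: "proper_young_diagram n Y"
    and "\<not> inj_on (record_points n) (avoiders Y [3, 1, 2])"
  shows "corner_excess (rev Y) 3"
proof -
  obtain \<pi> \<rho> where p: "\<pi> \<in> avoiders Y [3, 1, 2]" "\<rho> \<in> avoiders Y [3, 1, 2]"
    and rec: "record_points n \<pi> = record_points n \<rho>" and ne: "\<pi> \<noteq> \<rho>"
    using assms(2) by (auto simp: inj_on_def)
  have perm: "\<pi> permutes {1..n}" "\<rho> permutes {1..n}"
    using p proper_rows(1)[OF Y] by (auto simp: avoiders_def transversals_def)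
  have "inv \<pi> \<noteq> inv \<rho>" using ne permutes_inv_inv[OF perm(1)] permutes_inv_inv[OF perm(2)] by metis
  then obtain r where r: "inv \<pi> r \<noteq> inv \<rho> r" and least: "\<And>v. v < r \<Longrightarrow> inv \<pi> v = inv \<rho> v"
    using exists_least_iff[of "\<lambda>r. inv \<pi> r \<noteq> inv \<rho> r"] by blast
  have \<pi>: "\<pi> (inv \<pi> v) = v" "inv \<pi> (\<pi> v) = v" and \<rho>: "\<rho> (inv \<rho> v) = v" "inv \<rho> (\<rho> v) = v" for v
    using permutes_inverses[OF perm(1)] permutes_inverses[OF perm(2)] by auto
  have 1: "\<pi> x = \<rho> x" if "\<pi> x < r" for x using least[OF that] \<pi> \<rho> by metis
  have 2: "\<rho> x = \<pi> x" if "\<rho> x < r" for x using least[OF that] \<pi> \<rho> by metis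
  show ?thesis
    using r corner_of_two_312_avoiders[OF Y p rec, of "inv \<pi> r" r "inv \<rho> r"]
      corner_of_two_312_avoiders[OF Y p(2,1) rec[symmetric], of "inv \<rho> r" r "inv \<pi> r"] \<pi> \<rho> 1 2
    by (metis linorder_neqE_nat)
qed

text \<open>
  For a critical point \<open>(x, y)\<close>: the columns other than \<open>y + 1\<close>, \<open>x\<close>,
  \<open>x + 1\<close> are filled increasingly with the rows other than \<open>y\<close>, \<open>y + 1\<close>,
  \<open>y + 3\<close>, and the three remaining columns receive the rows \<open>u\<close>, \<open>v\<close>, \<open>w\<close>.
\<close>

definition corner_filling :: "nat \<Rightarrow> nat \<Rightarrow> nat \<Rightarrow> nat \<Rightarrow> nat \<Rightarrow> nat \<Rightarrow> nat" where
  "corner_filling y x u v w j =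
     (if j < y then j else if j = y + 1 then u else if j = x then v else if j = x + 1 then w
      else if j < x then j + 2 else j)"

lemma corner_filling_permutes:
  assumes "1 \<le> y" "y + 3 \<le> x" "x < n" "(u, v, w) = (y + 1, y, y + 3) \<or> (u, v, w) = (y, y + 3, y + 1)"
  shows "corner_filling y x u v w permutes {1..n}"
proof (rule bij_imp_permutes)
  have d: "u \<noteq> v" "u \<noteq> w" "v \<noteq> w" and m: "u \<in> {y, y + 1, y + 3}" "v \<in> {y, y + 1, y + 3}" "w \<in> {y, y + 1, y + 3}"
    using assms(4) by auto
  let ?f = "corner_filling y x u v w"
  have inj: "inj_on ?f {1..n}"
  proof (rule inj_onI)
    fix i j assume "i \<in> {1..n}" "j \<in> {1..n}" "corner_filling y x u v w i = corner_filling y x u v w j"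
    note eq = this(3)
    let ?E = "{y + 1, x, x + 1}"
    have val: "?f (y + 1) = u" "?f x = v" "?f (x + 1) = w"
      using assms(2) by (simp_all add: corner_filling_def)
    have outside: "?f l \<notin> {y, y + 1, y + 3}" if "l \<notin> ?E" for l
      using that assms(2) by (simp add: corner_filling_def)
    have inside: "?f l \<in> {y, y + 1, y + 3}" if "l \<in> ?E" for l
      using that val m by fastforce
    consider "i \<in> ?E" "j \<in> ?E" | "i \<notin> ?E" "j \<notin> ?E"
      using outside[of i] inside[of i] outside[of j] inside[of j] eq by auto
    then show "i = j"
    proof cases
      case 1
      then show ?thesis using val d eq by auto
    next
      case 2
      have mono: "?f a < ?f b" if "a < b" "a \<notin> ?E" "b \<notin> ?E" for a b
        using that by (simp add: corner_filling_def)
      show ?thesis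
      proof (rule ccontr)
        assume "i \<noteq> j"
        then consider "i < j" | "j < i" by linarith
        then have "?f i \<noteq> ?f j"
          by cases (use mono[OF _ 2] mono[OF _ 2(2,1)] in \<open>metis less_irrefl\<close>)+
        then show False using eq by contradiction
      qed
    qed
  qed
  have range: "u \<in> {1..n}" "v \<in> {1..n}" "w \<in> {1..n}" using m assms(1-3) by auto
  have "?f j \<in> {1..n}" if "j \<in> {1..n}" for j
    using that range assms(3) by (simp add: corner_filling_def)
  then have "?f ` {1..n} \<subseteq> {1..n}" by blast
  then show "bij_betw ?f {1..n} {1..n}"
    using inj by (simp add: bij_betw_def endo_inj_surj)
  show "?f j = j" if "j \<notin> {1..n}" for j
  proof -
    have "j < y \<or> x + 1 < j" using that assms(1-3) by auto
    then show ?thesis using assms(2) by (auto simp: corner_filling_def)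
  qed
qed

lemma record_points_corner_filling:
  assumes "1 \<le> y" "y + 3 \<le> x" "x < n" "(u, v, w) = (y + 1, y, y + 3) \<or> (u, v, w) = (y, y + 3, y + 1)"
  shows "record_points n (corner_filling y x u v w) =
    (\<lambda>j. (j, if j < y then j else if j < x then j + 2 else j)) ` ({1..n} - {y + 1, x, x + 1})"
proof -
  let ?f = "corner_filling y x u v w"
  let ?g = "\<lambda>j. if j < y then j else if j < x then j + 2 else j"
  have m: "v \<le> y + 3" "w \<le> y + 3" and u: "u \<le> y + 1" using assms(4) by auto
  have val: "?f y = y + 2" "?f (y + 2) = y + 4" "?f (y + 1) = u" "?f x = v" "?f (x + 1) = w"
    using assms(1,2) by (simp_all add: corner_filling_def)
  have rec: "(\<forall>i\<in>{1..<j}. ?f i < ?f j) \<longleftrightarrow> j \<notin> {y + 1, x, x + 1}" for j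
  proof
    assume *: "\<forall>i\<in>{1..<j}. ?f i < ?f j"
    show "j \<notin> {y + 1, x, x + 1}"
    proof
      assume "j \<in> {y + 1, x, x + 1}"
      then consider "j = y + 1" | "j = x" | "j = x + 1" by auto
      then show False
      proof cases
        case 1
        then have "?f y < ?f (y + 1)" using *[rule_format, of y] assms(1) by simp
        then show False using val assms(4) by auto
      next
        case 2
        then have "?f (y + 2) < ?f x" using *[rule_format, of "y + 2"] assms(2) by simp
        then show False using val m by simp
      next
        case 3
        then have "?f (y + 2) < ?f (x + 1)" using *[rule_format, of "y + 2"] assms(2) by simp
        then show False using val m by simp
      qed
    qed
  next
    assume j: "j \<notin> {y + 1, x, x + 1}"
    show "\<forall>i\<in>{1..<j}. ?f i < ?f j"
    proof
      fix i assume "i \<in> {1..<j}"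
      then show "?f i < ?f j"
        using j m u assms(1,2) by (simp add: corner_filling_def)
    qed
  qed
  have "?f j = ?g j" if "j \<notin> {y + 1, x, x + 1}" for j
    using that by (simp add: corner_filling_def)
  then show ?thesis unfolding record_points_def rec by auto
qed

lemma corner_filling_transversal:
  assumes Y: "proper_young_diagram n Y" and y: "1 \<le> y" "y + 3 \<le> x" "x < n"
    and row: "(x, y) \<in> cells Y" "(x + 1, y + 1) \<in> cells Y"
    and uvw: "(u, v, w) = (y + 1, y, y + 3) \<or> (u, v, w) = (y, y + 3, y + 1)"
  shows "corner_filling y x u v w \<in> transversals Y"
proof -
  let ?f = "corner_filling y x u v w"
  note n = proper_rows(1)[OF Y]
  have perm: "?f permutes {1..n}" by (rule corner_filling_permutes[OF y uvw])
  have m: "y \<le> u" "y \<le> v" "y + 1 \<le> w" using uvw by auto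
  have le: "?f j \<le> n" if "j \<in> {1..n}" for j using permutes_in_image[OF perm, of j] that by auto
  have "(j, ?f j) \<in> cells Y" if j: "j \<in> {1..n}" for j
  proof -
    have diag: "(j, j) \<in> cells Y"
      using proper_rows(3)[OF Y, of "j - 1"] j n by (auto simp: mem_cells_iff)
    have "j \<notin> {y + 1, x, x + 1} \<Longrightarrow> j \<le> ?f j" by (simp add: corner_filling_def)
    then consider "j = y + 1" | "j = x" | "j = x + 1" | "j \<le> ?f j" by blast
    then show ?thesis
    proof cases
      case 4
      then show ?thesis using cells_closed[OF Y diag, of j "?f j"] le[OF j] j by auto
    next
      case 1
      then have "?f j = u" using y by (simp add: corner_filling_def)
      then show ?thesis using cells_closed[OF Y row(1), of j u] 1 y m le[OF j] by auto
    next
      case 2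
      then have "?f j = v" using y by (simp add: corner_filling_def)
      then show ?thesis using cells_closed[OF Y row(1), of j v] 2 y m le[OF j] by auto
    next
      case 3
      then have "?f j = w" using y by (simp add: corner_filling_def)
      then show ?thesis using cells_closed[OF Y row(2), of j w] 3 y m le[OF j] by auto
    qed
  qed
  then show ?thesis using perm n by (simp add: transversals_def)
qed

text \<open>
  The two smaller entries of an occurrence of 312 lie in the columns \<open>y + 1\<close>, \<open>x\<close>,
  \<open>x + 1\<close>. An increasing pair there either starts in row \<open>y\<close> and ends in column
  \<open>x + 1\<close>, but the cell \<open>(x + 1, y)\<close> is missing, or it starts in column \<open>y + 1\<close>
  and ends with the entry \<open>y + 3\<close>, which no entry further left exceeds.
\<close>

lemma corner_filling_avoids_312:
  assumes Y: "proper_young_diagram n Y" and y: "1 \<le> y" "y + 3 \<le> x" "x < n"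
    and row: "(x, y) \<in> cells Y" "(x + 1, y + 1) \<in> cells Y" "(x + 1, y) \<notin> cells Y"
    and uvw: "(u, v, w) = (y + 1, y, y + 3) \<or> (u, v, w) = (y, y + 3, y + 1)"
  shows "corner_filling y x u v w \<in> avoiders Y [3, 1, 2]"
proof -
  let ?f = "corner_filling y x u v w"
  note n = proper_rows(1)[OF Y]
  have val: "?f (y + 1) = u" "?f x = v" "?f (x + 1) = w"
    using y by (simp_all add: corner_filling_def)
  have "\<not> contains_pattern Y ?f [3, 1, 2]"
  proof
    assume "contains_pattern Y ?f [3, 1, 2]"
    then obtain x1 x2 x3 where x: "1 \<le> x1" "x1 < x2" "x2 < x3" "x3 \<le> n" "?f x2 < ?f x3" "?f x3 < ?f x1"
      "(x3, ?f x2) \<in> cells Y" unfolding contains_312 n by blast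
    have "j \<in> {y + 1, x, x + 1}" if "x1 < j" "j \<le> n" "?f j < ?f x1" for j
    proof (rule ccontr)
      assume "j \<notin> {y + 1, x, x + 1}"
      then have "(j, ?f j) \<in> record_points n ?f"
        using that x(1) unfolding record_points_corner_filling[OF y uvw]
        by (intro image_eqI[of _ _ j]) (auto simp: corner_filling_def)
      then have "?f x1 < ?f j" using that x(1) by (auto simp: record_points_def)
      then show False using that by simp
    qed
    from this[of x2] this[of x3] x have "x2 \<in> {y + 1, x, x + 1}" "x3 \<in> {y + 1, x, x + 1}" by auto
    then consider "x2 = y + 1" "x3 = x" | "x2 = y + 1" "x3 = x + 1" | "x2 = x" "x3 = x + 1"
      using x(3) y by auto
    then show False
    proof cases
      case 1
      have "?f x1 \<le> y + 2" using x(2) 1 y by (auto simp: corner_filling_def)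
      then show False using x(5,6) 1 val uvw by auto
    next
      case 2
      have "?f x1 \<le> y + 2" using x(2) 2 y by (auto simp: corner_filling_def)
      then show False using x(5,6,7) 2 val uvw row(3) by auto
    next
      case 3
      then show False using x(5,7) val uvw row(3) by auto
    qed
  qed
  then show ?thesis
    using corner_filling_transversal[OF Y y row(1,2) uvw] by (simp add: avoiders_def)
qed

lemma not_inj_if_corner:
  assumes Y: "proper_young_diagram n Y" and "corner_excess (rev Y) 3"
  shows "\<not> inj_on (record_points n) (avoiders Y [3, 1, 2])"
proof
  note rows = proper_rows[OF Y]
  obtain k where k: "Suc k < n" "rev Y ! k < rev Y ! Suc k" "Suc k + 3 \<le> rev Y ! k"
    using assms(2) rows(1) by (auto simp: corner_excess_def)
  define y where "y = Suc k"
  define x where "x = rev Y ! k"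
  have y: "1 \<le> y" "y + 3 \<le> x" "x < n"
    using k rows(5)[of "Suc k"] by (auto simp: y_def x_def)
  have cells: "(x, y) \<in> cells Y" "(x + 1, y + 1) \<in> cells Y" "(x + 1, y) \<notin> cells Y"
    using k rows(1) by (auto simp: mem_cells_iff y_def x_def)
  let ?p = "corner_filling y x (y + 1) y (y + 3)"
  let ?q = "corner_filling y x y (y + 3) (y + 1)"
  assume inj: "inj_on (record_points n) (avoiders Y [3, 1, 2])"
  have "?p \<in> avoiders Y [3, 1, 2]" "?q \<in> avoiders Y [3, 1, 2]"
    by (rule corner_filling_avoids_312[OF Y y cells]; simp)+
  moreover have "record_points n ?p = record_points n ?q"
    using y by (subst (1 2) record_points_corner_filling) auto
  ultimately have "?p = ?q" using inj by (auto dest: inj_onD)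
  then have "?p x = ?q x" by simp
  then show False using y by (simp add: corner_filling_def)
qed

lemma card_321_less_312:
  assumes "proper_young_diagram n Y"
  shows "card (avoiders Y [3, 2, 1]) < card (avoiders Y [3, 1, 2]) \<longleftrightarrow> corner_excess (rev Y) 3"
  using card_321_less_312_iff[OF assms] corner_if_not_inj[OF assms] not_inj_if_corner[OF assms] by blast

lemma turn_from_row:
  "Suc r < length cs \<Longrightarrow> cs ! r < cs ! Suc r \<Longrightarrow> sorted (x # cs) \<Longrightarrow>
    \<exists>w s. border_from x cs = w @ Upwards # Rightwards # s \<and>
      count_list w Upwards = r \<and> x + count_list w Rightwards = cs ! r"
proof (induction r arbitrary: x cs)
  case 0
  then obtain c d ds where cs: "cs = c # d # ds" "c < d" by (cases cs; cases "tl cs") auto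
  then obtain m where m: "d - c = Suc m" by (metis Suc_diff_Suc)
  have "count_list (replicate k Rightwards) Rightwards = k"
    "count_list (replicate k Rightwards) Upwards = 0" for k
    by (induction k) auto
  then show ?case using 0 cs m
    by (intro exI[of _ "replicate (c - x) Rightwards"] exI[of _ "replicate m Rightwards @ Upwards # border_from d ds"])
       auto
next
  case (Suc r)
  then obtain c ds where cs: "cs = c # ds" by (cases cs) auto
  then obtain w s where ws: "border_from c ds = w @ Upwards # Rightwards # s"
    "count_list w Upwards = r" "c + count_list w Rightwards = ds ! r"
    using Suc.IH[of ds c] Suc.prems by auto
  have "count_list (replicate k Rightwards) Rightwards = k"
    "count_list (replicate k Rightwards) Upwards = 0" for k
    by (induction k) auto
  then show ?case using ws cs Suc.prems
    by (intro exI[of _ "replicate (c - x) Rightwards @ Upwards # w"] exI[of _ s]) auto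
qed

lemma row_from_turn:
  "border_from x cs = w @ Upwards # Rightwards # s \<Longrightarrow> sorted (x # cs) \<Longrightarrow>
    \<exists>r. Suc r < length cs \<and> cs ! r < cs ! Suc r \<and>
      count_list w Upwards = r \<and> x + count_list w Rightwards = cs ! r"
proof (induction cs arbitrary: x w)
  case (Cons c cs)
  have count: "count_list (replicate k Rightwards) Rightwards = k"
    "count_list (replicate k Rightwards) Upwards = 0" for k
    by (induction k) auto
  have xc: "x \<le> c" using Cons.prems(2) by simp
  have eq: "replicate (c - x) Rightwards @ Upwards # border_from c cs = w @ Upwards # Rightwards # s"
    using Cons.prems(1) by simp
  consider "w = replicate (c - x) Rightwards" "border_from c cs = Rightwards # s"
    | w' where "w = replicate (c - x) Rightwards @ Upwards # w'"
        "border_from c cs = w' @ Upwards # Rightwards # s"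
  proof -
    from eq[unfolded append_eq_append_conv2] obtain us where
      "(replicate (c - x) Rightwards = w @ us \<and> us @ Upwards # border_from c cs = Upwards # Rightwards # s) \<or>
       (replicate (c - x) Rightwards @ us = w \<and> Upwards # border_from c cs = us @ Upwards # Rightwards # s)"
      by blast
    then show thesis
    proof
      assume a: "replicate (c - x) Rightwards = w @ us \<and> us @ Upwards # border_from c cs = Upwards # Rightwards # s"
      have "us = []"
      proof (cases us)
        case (Cons z zs)
        then have "Upwards \<in> set (replicate (c - x) Rightwards)" using a by auto
        then show ?thesis by (auto split: if_splits)
      qed
      then show thesis using a that(1) by simp
    next
      assume a: "replicate (c - x) Rightwards @ us = w \<and> Upwards # border_from c cs = us @ Upwards # Rightwards # s"
      show thesis
      proof (cases us)
        case Nil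
        then show thesis using a that(1) by simp
      next
        case (Cons z zs)
        then have "w = replicate (c - x) Rightwards @ Upwards # zs"
          "border_from c cs = zs @ Upwards # Rightwards # s" using a by auto
        then show thesis by (rule that(2))
      qed
    qed
  qed
  then show ?case
  proof cases
    case 1
    then obtain d ds where cs: "cs = d # ds" by (cases cs) auto
    then have "c < d" using 1(2) by (cases "d - c") auto
    then show ?thesis using 1(1) cs xc by (simp add: count)
  next
    case 2
    then obtain r where "Suc r < length cs" "cs ! r < cs ! Suc r" "count_list w' Upwards = r"
      "c + count_list w' Rightwards = cs ! r" using Cons.IH[of c w'] Cons.prems(2) by auto
    then show ?thesis using 2(1) xc by (intro exI[of _ "Suc r"]) (simp add: count)
  qed
qed simp

text \<open>
  The border turns from up to right at a point \<open>(X, Y)\<close> with \<open>X - Y \<ge> m\<close>.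
\<close>

definition turn_excess :: "step list \<Rightarrow> nat \<Rightarrow> bool" where
  "turn_excess b m \<longleftrightarrow> (\<exists>w s. b = w @ Upwards # Rightwards # s \<and>
     Suc (count_list w Upwards) + m \<le> count_list w Rightwards)"

lemma turn_excess_iff_corner:
  assumes "proper_young_diagram n Y"
  shows "turn_excess (border Y) m \<longleftrightarrow> corner_excess (rev Y) m"
proof -
  have "sorted (0 # rev Y)" using proper_rows(2)[OF assms] by simp
  then show ?thesis
    unfolding turn_excess_def corner_excess_def border_def
    using row_from_turn[of 0 "rev Y"] turn_from_row[of _ "rev Y" 0] by (metis add_0)
qed

lemma critical_iff_turn_excess:
  "(\<exists>i\<ge>int m. \<exists>P. i_critical_point Y i P) \<longleftrightarrow> turn_excess (border Y) m"
proof
  assume "\<exists>i\<ge>int m. \<exists>P. i_critical_point Y i P"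
  then obtain P where "critical_point Y P" "int m \<le> int (fst P) - int (snd P)"
    by (auto simp: i_critical_point_def)
  then obtain k where k: "Suc k < length (border Y)" "border Y ! k = Upwards"
    "border Y ! Suc k = Rightwards"
    and ge: "int m \<le> int (fst (border_point Y (Suc k))) - int (snd (border_point Y (Suc k)))"
    unfolding critical_point_def by blast
  have b: "border Y = take k (border Y) @ Upwards # Rightwards # drop (Suc (Suc k)) (border Y)"
    using k by (metis Cons_nth_drop_Suc Suc_lessD append_take_drop_id)
  have "take (Suc k) (border Y) = take k (border Y) @ [Upwards]"
    using k by (simp add: take_Suc_conv_app_nth)
  then have "Suc (count_list (take k (border Y)) Upwards) + m \<le> count_list (take k (border Y)) Rightwards"
    using ge by (simp add: border_point_def)
  then show "turn_excess (border Y) m" unfolding turn_excess_def using b by blast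
next
  assume "turn_excess (border Y) m"
  then obtain w s where b: "border Y = w @ Upwards # Rightwards # s"
    and ge: "Suc (count_list w Upwards) + m \<le> count_list w Rightwards"
    by (auto simp: turn_excess_def)
  let ?P = "border_point Y (Suc (length w))"
  have P: "?P = (count_list w Rightwards, Suc (count_list w Upwards))"
    by (simp add: border_point_def b)
  have "critical_point Y ?P"
    unfolding critical_point_def by (intro exI[of _ "length w"]) (simp add: b nth_append)
  then have "i_critical_point Y (int (fst ?P) - int (snd ?P)) ?P" by (simp add: i_critical_point_def)
  moreover have "int m \<le> int (fst ?P) - int (snd ?P)" using ge by (simp add: P)
  ultimately show "\<exists>i\<ge>int m. \<exists>P. i_critical_point Y i P" by blast
qed

lemma num213_less_num123_iff:
  assumes b: "leads_to 0 b 0"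
  shows "num213 [] b < num123 [] b \<longleftrightarrow> turn_excess b 2"
proof
  assume "turn_excess b 2"
  then obtain w s where ws: "b = w @ Upwards # Rightwards # s"
    "Suc (count_list w Upwards) + 2 \<le> count_list w Rightwards"
    by (auto simp: turn_excess_def)
  have "b = (w @ [Upwards]) @ Rightwards # s" using ws by simp
  then obtain h where h: "leads_to 0 (w @ [Upwards]) h" using b unfolding leads_to_append[of _ "w @ [Upwards]"]
    by (metis leads_to_append)
  then have "h \<ge> 2" using leads_to_count[OF h] ws(2) by simp
  then show "num213 [] b < num123 [] b" using num213_less_num123[OF h] ws(1) by simp
next
  assume less: "num213 [] b < num123 [] b"
  show "turn_excess b 2"
  proof (rule ccontr)
    assume "\<not> turn_excess b 2"
    then have "num213 [] b = num123 [] b"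
      using b by (intro num213_eq_num123[of 0]) (force simp: turn_excess_def not_le)+
    then show False using less by simp
  qed
qed

theorem theorem2:
  fixes n :: nat and Y :: "nat list"
  assumes "proper_young_diagram n Y"
  shows "(card (avoiders Y [2, 1, 3]) < card (avoiders Y [1, 2, 3]) \<longleftrightarrow>
            (\<exists>i\<ge>2. \<exists>P. i_critical_point Y i P)) \<and>
         (card (avoiders Y [1, 2, 3]) < card (avoiders Y [3, 1, 2]) \<longleftrightarrow>
            (\<exists>i\<ge>3. \<exists>P. i_critical_point Y i P))"
proof -
  note b = leads_to_border[OF assms]
  have 2: "(\<exists>i\<ge>2. \<exists>P. i_critical_point Y i P) \<longleftrightarrow> turn_excess (border Y) 2"
    using critical_iff_turn_excess[of 2 Y] by simp
  have 3: "(\<exists>i\<ge>3. \<exists>P. i_critical_point Y i P) \<longleftrightarrow> corner_excess (rev Y) 3"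
    using critical_iff_turn_excess[of 3 Y] turn_excess_iff_corner[OF assms, of 3] by simp
  have "card (avoiders Y [1, 2, 3]) = card (avoiders Y [3, 2, 1])"
    using card_avoiders_123[OF assms] card_avoiders_321[OF assms] num123_eq_num321[OF b] by simp
  then show ?thesis
    unfolding 2 3 using card_321_less_312[OF assms]
      card_avoiders_213[OF assms] card_avoiders_123[OF assms] num213_less_num123_iff[OF b] by simp
qed

end
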